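(* Let $X\in\mathbb{R}^{n\times p}$ with $\operatorname{rank}(X)=p$, let $D\in\mathbb{R}^{m\times p}$ be an arbitrary matrix and let $y\in\mathbb{R}^n$. Let $\hat u_\lambda$, $\lambda\ge 0$, be the dual path constructed by the dual path algorithm described in the context, applied to $\tilde y=XX^+y$ and $\tilde D=DX^+$, and suppose that the algorithm terminates after $T$ iterations, having visited the values $\lambda_1,\ldots,\lambda_T$. Then: (i) $\hat u_\lambda$ is a solution of the dual problem at each $\lambda$, and, as a function of $\lambda$, the path $\hat u_\lambda$ is piecewise linear, with kinks (changes in slope) at $\lambda_1,\ldots,\lambda_T$, and is continuous. (ii) Consequently the primal solution path $\hat\beta_\lambda$ of the generalized lasso problem $$\min_{\beta\in\mathbb{R}^p}\ \tfrac12\|y-X\beta\|_2^2+\lambda\|D\beta\|_1 ,$$ which is obtained from $\hat u_\lambda$ by the linear transformation $\hat\beta_\lambda=X^+(\tilde y-\tilde D^T\hat u_\lambda)$, is also a continuous and piecewise linear function of $\lambda$. Its kinks are necessarily a subset of $\{\lambda_1,\ldots,\lambda_T\}$ (this could be a strict inclusion, as $\operatorname{rank}(D)$ could be less than $m$).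
   Context: $A^+$ denotes the Moore–Penrose pseudoinverse of $A$; for rectangular $X$, $X^+=(X^TX)^+X^T$. Dual problem at $\lambda$: minimize $\tfrac12\|\tilde y-\tilde D^Tu\|_2^2$ over $u\in\mathbb{R}^m$ subject to $\|u\|_\infty\le\lambda$. Its solution need not be unique. Notation: for an ordered list $\mathcal B$ of indices from $\{1,\ldots,m\}$, $\tilde D_{\mathcal B}$ and $u_{\mathcal B}$ denote the rows of $\tilde D$ and the coordinates of $u$ indexed by $\mathcal B$; the subscript $-\mathcal B$ denotes all rows or coordinates except those in $\mathcal B$. The list $\mathcal B$ holds the current boundary coordinates (those with $|\hat u_{\lambda,i}|=\lambda$), and the vector $s$ holds their signs. Dual path algorithm: start with $k=0$, $\lambda_0=\infty$, $\mathcal B=\varnothing$, $s=\varnothing$. While $\lambda_k>0$: 1. Use the pseudoinverse least squares solution: with $$a=\big(\tilde D_{-\mathcal B}(\tilde D_{-\mathcal B})^T\big)^+\tilde D_{-\mathcal B}\,\tilde y,\qquad b=\big(\tilde D_{-\mathcal B}(\tilde D_{-\mathcal B})^T\big)^+\tilde D_{-\mathcal B}(\tilde D_{\mathcal B})^Ts,$$ the solution at $\lambda_k$ is $\hat u_{\lambda_k,\mathcal B}=\lambda_ks$, $\hat u_{\lambda_k,-\mathcal B}=a-\lambda_kb$. The path is continued as $\hat u_{\lambda,\mathcal B}=\lambda s$, $\hat u_{\lambda,-\mathcal B}=a-\lambda b$ for decreasing $\lambda$, down to the value $\lambda_{k+1}$ determined in step 4. 2. The next hitting time is $h_{k+1}=\max_i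 t_i^{(\mathrm{hit})}$ over interior coordinates $i$ (those not in $\mathcal B$), where $t_i^{(\mathrm{hit})}=a_i/(b_i\pm1)$, the sign being the one that gives a value in $[0,\lambda_k]$. The maximizing coordinate is the hitting coordinate. 3. With $R=I-(\tilde D_{-\mathcal B})^T\big(\tilde D_{-\mathcal B}(\tilde D_{-\mathcal B})^T\big)^+\tilde D_{-\mathcal B}$, set for each boundary coordinate $c_i=s_i\,[\tilde D_{\mathcal B}R\tilde y]_i$ and $d_i=s_i\,[\tilde D_{\mathcal B}R(\tilde D_{\mathcal B})^Ts]_i$. The next leaving time is $l_{k+1}=\max_i t_i^{(\mathrm{leave})}$ over boundary coordinates, where $t_i^{(\mathrm{leave})}=c_i/d_i$ if $c_i<0$ and $d_i<0$, and $t_i^{(\mathrm{leave})}=0$ otherwise. The maximizing coordinate is the leaving coordinate. 4. Set $\lambda_{k+1}=\max\{h_{k+1},l_{k+1}\}$. If $h_{k+1}>l_{k+1}$, add the hitting coordinate to $\mathcal B$ and its sign (that of $\hat u_{\lambda_{k+1}}$ at this coordinate) to $s$; otherwise remove the leaving coordinate from $\mathcal B$ and its sign from $s$. Set $k=k+1$. A maximum over an empty set of coordinates is taken to be $0$. *)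

theory Defs
  imports "HOL-Analysis.Analysis"
begin

section \<open>Moore--Penrose pseudoinverse\<close>

definition is_mp_inverse :: "real^'n^'m \<Rightarrow> real^'m^'n \<Rightarrow> bool" where
  "is_mp_inverse A G \<longleftrightarrow>
     A ** G ** A = A \<and> G ** A ** G = G \<and>
     transpose (A ** G) = A ** G \<and> transpose (G ** A) = G ** A"

definition mp_inverse :: "real^'n^'m \<Rightarrow> real^'m^'n" where
  "mp_inverse A = (THE G. is_mp_inverse A G)"

definition rect_pinv :: "real^'p^'n \<Rightarrow> real^'n^'p" where
  "rect_pinv X = mp_inverse (transpose X ** X) ** transpose X"


section \<open>Primal and dual problems\<close>

definition genlasso_objective ::
    "real^'p^'n \<Rightarrow> real^'p^'m \<Rightarrow> real^'n \<Rightarrow> real \<Rightarrow> real^'p \<Rightarrow> real" where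
  "genlasso_objective X D y l \<beta> =
     1/2 * (norm (y - X *v \<beta>))^2 + l * (\<Sum>i\<in>UNIV. \<bar>(D *v \<beta>) $ i\<bar>)"

definition primal_solution ::
    "real^'p^'n \<Rightarrow> real^'p^'m \<Rightarrow> real^'n \<Rightarrow> real \<Rightarrow> real^'p \<Rightarrow> bool" where
  "primal_solution X D y l \<beta> \<longleftrightarrow> is_arg_min (genlasso_objective X D y l) (\<lambda>_. True) \<beta>"

definition dual_solution :: "real^'n \<Rightarrow> real^'n^'m \<Rightarrow> real \<Rightarrow> real^'m \<Rightarrow> bool" where
  "dual_solution yt Dt l u \<longleftrightarrow>
     is_arg_min (\<lambda>u. 1/2 * (norm (yt - transpose Dt *v u))^2) (\<lambda>u. infnorm u \<le> l) u"

definition y_tilde :: "real^'p^'n \<Rightarrow> real^'n \<Rightarrow> real^'n" where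
  "y_tilde X y = (X ** rect_pinv X) *v y"

definition D_tilde :: "real^'p^'n \<Rightarrow> real^'p^'m \<Rightarrow> real^'n^'m" where
  "D_tilde X D = D ** rect_pinv X"

definition primal_path ::
    "real^'p^'n \<Rightarrow> real^'p^'m \<Rightarrow> real^'n \<Rightarrow> (real \<Rightarrow> real^'m) \<Rightarrow> real \<Rightarrow> real^'p" where
  "primal_path X D y u l = rect_pinv X *v (y_tilde X y - transpose (D_tilde X D) *v u l)"


section \<open>The dual path algorithm\<close>

text \<open>
  The boundary set changes along the path, so a matrix made of the rows indexed by \<open>S\<close>
  keeps its full shape and has zero rows outside \<open>S\<close>. Its Gram matrix is then the Gram matrix
  of the submatrix bordered by zeros, and so is the Moore--Penrose inverse of that Gram matrix;
  hence every quantity below has the value of the submatrix formula on the relevant index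
  set, and the pseudoinverse formulas give 0 outside it. In the same way a sign
  vector \<open>s\<close> indexed by \<open>B\<close> is a vector that vanishes outside \<open>B\<close>.
\<close>

definition rows_in :: "real^'n^'m \<Rightarrow> 'm set \<Rightarrow> real^'n^'m" where
  "rows_in A S = (\<chi> i. if i \<in> S then A $ i else 0)"

definition ls_pinv :: "real^'n^'m \<Rightarrow> 'm set \<Rightarrow> real^'n^'m" where
  "ls_pinv Dt B =
     mp_inverse (rows_in Dt (-B) ** transpose (rows_in Dt (-B))) ** rows_in Dt (-B)"

definition coef_a :: "real^'n \<Rightarrow> real^'n^'m \<Rightarrow> 'm set \<Rightarrow> real^'m" where
  "coef_a yt Dt B = ls_pinv Dt B *v yt"

definition coef_b :: "real^'n^'m \<Rightarrow> 'm set \<Rightarrow> real^'m \<Rightarrow> real^'m" where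
  "coef_b Dt B s = ls_pinv Dt B *v (transpose (rows_in Dt B) *v s)"

definition path_piece ::
    "real^'n \<Rightarrow> real^'n^'m \<Rightarrow> 'm set \<Rightarrow> real^'m \<Rightarrow> real \<Rightarrow> real^'m" where
  "path_piece yt Dt B s l =
     (\<chi> i. if i \<in> B then l * s $ i else coef_a yt Dt B $ i - l * coef_b Dt B s $ i)"

text \<open>
  A coordinate that has just left the boundary has two admissible signs, one of them giving the
  current value \<open>lk\<close> itself. Any admissible choice is allowed. The requirement on the
  denominator excludes the HOL convention \<open>x / 0 = 0\<close>.
\<close>

definition is_hit_time :: "ereal \<Rightarrow> real \<Rightarrow> real \<Rightarrow> real \<Rightarrow> bool" where
  "is_hit_time lk ai bi t \<longleftrightarrow>
     (\<exists>\<sigma>\<in>{1, -1}. bi + \<sigma> \<noteq> 0 \<and> t = ai / (bi + \<sigma>)) \<and> 0 \<le> t \<and> ereal t \<le> lk"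

definition resid_proj :: "real^'n^'m \<Rightarrow> 'm set \<Rightarrow> real^'n^'n" where
  "resid_proj Dt B = mat 1 - transpose (rows_in Dt (-B)) ** ls_pinv Dt B"

definition coef_c :: "real^'n \<Rightarrow> real^'n^'m \<Rightarrow> 'm set \<Rightarrow> real^'m \<Rightarrow> 'm \<Rightarrow> real" where
  "coef_c yt Dt B s i = s $ i * (rows_in Dt B *v (resid_proj Dt B *v yt)) $ i"

definition coef_d :: "real^'n^'m \<Rightarrow> 'm set \<Rightarrow> real^'m \<Rightarrow> 'm \<Rightarrow> real" where
  "coef_d Dt B s i =
     s $ i * (rows_in Dt B *v (resid_proj Dt B *v (transpose (rows_in Dt B) *v s))) $ i"

definition leave_time :: "real^'n \<Rightarrow> real^'n^'m \<Rightarrow> 'm set \<Rightarrow> real^'m \<Rightarrow> 'm \<Rightarrow> real" where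
  "leave_time yt Dt B s i =
     (if coef_c yt Dt B s i < 0 \<and> coef_d Dt B s i < 0
      then coef_c yt Dt B s i / coef_d Dt B s i else 0)"

definition max_or_zero :: "('a \<Rightarrow> real) \<Rightarrow> 'a set \<Rightarrow> real" where
  "max_or_zero f S = (if S = {} then 0 else Max (f ` S))"

text \<open>
  One iteration, as a relation: ties between maximizing coordinates may be broken in any way.
  If \<open>B\<close> is empty and no positive hitting time exists, there is no coordinate to remove; the
  next value is then 0 and the algorithm stops.
\<close>

definition dual_step ::
    "real^'n \<Rightarrow> real^'n^'m \<Rightarrow> ereal \<Rightarrow> 'm set \<Rightarrow> real^'m \<Rightarrow> ereal \<Rightarrow> 'm set \<Rightarrow> real^'m \<Rightarrow> bool" where
  "dual_step yt Dt lk B s lk' B' s' \<longleftrightarrow>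
     (\<exists>t h l.
        (\<forall>i\<in>-B. is_hit_time lk (coef_a yt Dt B $ i) (coef_b Dt B s $ i) (t i)) \<and>
        h = max_or_zero t (-B) \<and>
        l = max_or_zero (leave_time yt Dt B s) B \<and>
        lk' = ereal (max h l) \<and>
        (if h > l then
           \<exists>i\<in>-B. t i = h \<and> B' = insert i B \<and>
             s' = (\<chi> j. if j = i then sgn (path_piece yt Dt B s (max h l) $ i) else s $ j)
         else if B = {} then B' = B \<and> s' = s
         else
           \<exists>i\<in>B. leave_time yt Dt B s i = l \<and> B' = B - {i} \<and>
             s' = (\<chi> j. if j = i then 0 else s $ j)))"

definition dual_path_run ::
    "real^'n \<Rightarrow> real^'n^'m \<Rightarrow> nat \<Rightarrow> (nat \<Rightarrow> ereal) \<Rightarrow> (nat \<Rightarrow> 'm set) \<Rightarrow> (nat \<Rightarrow> real^'m) \<Rightarrow> bool"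
  where
  "dual_path_run yt Dt T lam B s \<longleftrightarrow>
     lam 0 = \<infinity> \<and> B 0 = {} \<and> s 0 = 0 \<and>
     (\<forall>k<T. lam k > 0 \<and>
        dual_step yt Dt (lam k) (B k) (s k) (lam (Suc k)) (B (Suc k)) (s (Suc k))) \<and>
     \<not> lam T > 0"

text \<open>
  At a value where consecutive pieces meet, the path may take the value of any of them; that
  they agree there is part of the continuity claim, not of this definition.
\<close>

definition is_dual_path ::
    "real^'n \<Rightarrow> real^'n^'m \<Rightarrow> nat \<Rightarrow> (nat \<Rightarrow> ereal) \<Rightarrow> (nat \<Rightarrow> 'm set) \<Rightarrow> (nat \<Rightarrow> real^'m) \<Rightarrow>
     (real \<Rightarrow> real^'m) \<Rightarrow> bool" where
  "is_dual_path yt Dt T lam B s u \<longleftrightarrow>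
     (\<forall>x\<ge>0. \<exists>k<T. lam (Suc k) \<le> ereal x \<and> ereal x \<le> lam k \<and>
        u x = path_piece yt Dt (B k) (s k) x)"

definition visited :: "nat \<Rightarrow> (nat \<Rightarrow> ereal) \<Rightarrow> real set" where
  "visited T lam = {x. ereal x \<in> lam ` {1..T}}"


section \<open>Piecewise linear paths\<close>

definition piecewise_linear_on :: "real set \<Rightarrow> (real \<Rightarrow> 'a::real_vector) \<Rightarrow> bool" where
  "piecewise_linear_on S f \<longleftrightarrow>
     (\<exists>K. finite K \<and>
        (\<forall>I. is_interval I \<and> I \<subseteq> S - K \<longrightarrow> (\<exists>c v. \<forall>x\<in>I. f x = c + x *\<^sub>R v)))"

text \<open>
  Paths have domain \<open>{0..}\<close>. A change in slope needs a slope on both sides, so the endpoint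
  \<open>0\<close> (always the last value visited by the algorithm) is not a kink.
\<close>

definition kinks :: "(real \<Rightarrow> 'a::real_normed_vector) \<Rightarrow> real set" where
  "kinks f =
     {x. 0 < x \<and> (\<exists>v w. v \<noteq> w \<and> (f has_vector_derivative v) (at_left x) \<and>
                         (f has_vector_derivative w) (at_right x))}"

end

theory Submission
  imports Defs
begin

text \<open>
  Fix \<open>B\<close> and \<open>s\<close>. The vector produced by the pseudoinverse formulas is the unique \<open>p\<close> that
  equals \<open>l s\<close> on \<open>B\<close>, has vanishing gradient off \<open>B\<close>, and agrees off \<open>B\<close> with
  some \<open>Dt *v x\<close> (\<open>path_piece_iff\<close>). It is affine in \<open>l\<close>, and it solves the dual problem as
  long as it stays in the box and the negative gradient at the coordinates in \<open>B\<close> points outward,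
  in the direction of \<open>s\<close>.

  Hitting times are where an interior coordinate reaches the box, leaving times where a boundary
  gradient changes sign; so validity persists from the start of a piece to the next event
  (\<open>piece_valid_until_event\<close>). At an event the three conditions for the new pair \<open>(B, s)\<close> hold for
  the old vector: a coordinate that hits already has the value \<open>l s\<close>, and a coordinate that leaves
  has gradient 0 and a row independent of the interior rows, so that the range condition does
  not constrain it. By uniqueness the pieces match, which gives continuity, and validity is
  inherited by the next piece (\<open>dual_step_correct\<close>).

  Every event at a positive value is a kink (\<open>kinks_dual_path\<close>), also when several events share
  that value. The piece of positive length above it ceases to be optimal just below: its hitting
  coordinate leaves the box, or its leaving coordinate has a gradient of the wrong sign. The piece
  of positive length below it is optimal and agrees with the former at the value itself; equal
  slopes would make them equal.

  For the primal problem, the first-order condition of the dual problem says that \<open>u l\<close> is \<open>l\<close>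
  times a subgradient of the 1-norm at \<open>D *v \<beta>\<close>, where \<open>\<beta>\<close> is the linear image of
  \<open>u l\<close>; full column rank gives uniqueness (\<open>primal_solution_iff\<close>). A linear image of the path
  inherits continuity and piecewise linearity and can only lose kinks.
\<close>

text \<open>
  The transpose is kept as a matrix, since it interacts below with products of matrices.
\<close>

declare transpose_matrix_vector [simp del]

section \<open>Pseudoinverse least squares\<close>

lemma inner_matrix_vector_transpose:
  fixes A :: "real^'n^'m"
  shows "(A *v x) \<bullet> y = x \<bullet> (transpose A *v y)"
  using dot_lmul_matrix[of y A x] by (simp add: transpose_matrix_vector inner_commute)

lemma gram_kernel:
  fixes A :: "real^'n^'m"
  assumes "transpose A *v (A *v x) = 0"
  shows "A *v x = 0"
  using inner_matrix_vector_transpose[of A x "A *v x"] assms by simp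

lemma normal_equations_solvable:
  fixes A :: "real^'n^'m"
  obtains w where "transpose A *v (A *v w) = transpose A *v z"
proof -
  obtain p q where p: "p \<in> span (range ((*v) A))"
    and q: "\<And>w. w \<in> span (range ((*v) A)) \<Longrightarrow> orthogonal q w" and z: "z = p + q"
    using orthogonal_subspace_decomp_exists[of "range ((*v) A)" z] by metis
  have "span (range ((*v) A)) = range ((*v) A)"
    by (simp add: span_eq_iff linear_subspace_image)
  with p obtain w where w: "p = A *v w" by auto
  have "(A *v (transpose A *v q)) \<bullet> q = 0"
    using q[of "A *v (transpose A *v q)"] by (simp add: span_base orthogonal_def inner_commute)
  then have "transpose A *v q = 0"
    using inner_matrix_vector_transpose[of A "transpose A *v q" q] by simp
  then have "transpose A *v (A *v w) = transpose A *v z"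
    by (simp add: z w matrix_vector_right_distrib)
  then show thesis using that by blast
qed

lemma is_mp_inverse_unique:
  assumes "is_mp_inverse A G" and "is_mp_inverse A H"
  shows "G = H"
proof -
  have sym: "transpose (A ** G) = A ** G" "transpose (A ** H) = A ** H"
    "transpose (G ** A) = G ** A" "transpose (H ** A) = H ** A"
    and id: "A ** G ** A = A" "A ** H ** A = A" "G ** A ** G = G" "H ** A ** H = H"
    using assms by (auto simp: is_mp_inverse_def)
  have "A ** G = A ** H"
    by (metis id(1,2) matrix_mul_assoc matrix_transpose_mul sym(1,2))
  moreover have "G ** A = H ** A"
    by (metis id(1,2) matrix_mul_assoc matrix_transpose_mul sym(3,4))
  ultimately show ?thesis
    by (metis id(3,4) matrix_mul_assoc)
qed

text \<open>
  Solving the normal equations columnwise gives \<open>M\<close> with \<open>A A M = A\<close>. Then \<open>A M\<close> is a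
  symmetric idempotent that fixes \<open>A\<close>, that is, the orthogonal projection onto the range of
  \<open>A\<close>, and \<open>M\<^sup>T A M\<close> satisfies the Penrose equations by pure algebra; no spectral
  decomposition is involved.
\<close>

lemma symmetric_is_mp_inverse_ex:
  fixes A :: "real^'n^'n"
  assumes sym: "transpose A = A"
  shows "\<exists>G. is_mp_inverse A G"
proof -
  have "\<exists>w. A *v (A *v w) = A *v z" for z
    using normal_equations_solvable[of A z] sym by metis
  then obtain f where f: "\<And>z. A *v (A *v f z) = A *v z" by metis
  define M :: "real^'n^'n" where "M = transpose (\<chi> j. f (axis j 1))"
  have M_col: "M *v axis j 1 = f (axis j 1)" for j
    by (simp add: M_def matrix_vector_mult_basis column_def transpose_def vec_eq_iff)
  have col_eq: "P = Q" if "\<And>j. P *v axis j 1 = Q *v axis j (1::real)" for P Q :: "real^'n^'n"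
    using that by (simp add: matrix_vector_mult_basis column_def vec_eq_iff)
  have AAM: "A ** A ** M = A"
    by (rule col_eq) (simp only: matrix_vector_mul_assoc[symmetric] M_col f)
  define Q where "Q = A ** M"
  have AQ: "A ** Q = A" using AAM by (simp add: Q_def matrix_mul_assoc)
  have Qt: "transpose Q = transpose M ** A"
    by (simp add: Q_def matrix_transpose_mul sym)
  have QtA: "transpose Q ** A = A"
    using arg_cong[OF AQ, of transpose] by (simp add: matrix_transpose_mul sym)
  have "transpose Q = transpose Q ** Q"
    unfolding Qt by (metis AQ matrix_mul_assoc)
  then have Qs: "transpose Q = Q"
    by (metis matrix_transpose_mul transpose_transpose)
  then have QQ: "Q ** Q = Q" and MA: "transpose M ** A = Q" and QA: "Q ** A = A"
    using \<open>transpose Q = transpose Q ** Q\<close> Qt QtA by simp_all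
  let ?G = "transpose M ** A ** M"
  have AG: "A ** ?G = Q"
    by (metis AQ MA Q_def matrix_mul_assoc)
  have GA: "?G ** A = Q"
    by (metis MA Q_def QA matrix_mul_assoc)
  have QG: "Q ** ?G = ?G"
    by (metis MA QQ matrix_mul_assoc)
  have "is_mp_inverse A ?G"
    unfolding is_mp_inverse_def AG GA using Qs QA QG by simp
  then show ?thesis ..
qed

lemma mp_inverse_symmetric:
  fixes A :: "real^'n^'n"
  assumes "transpose A = A"
  shows "is_mp_inverse A (mp_inverse A)"
  unfolding mp_inverse_def
  using symmetric_is_mp_inverse_ex[OF assms] is_mp_inverse_unique by (metis theI)

text \<open>
  The vector \<open>(A A\<^sup>T)\<^sup>+ A z\<close> is the minimum norm least squares coefficient for regressing \<open>z\<close>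
  on the rows of \<open>A\<close>. Membership in the range of \<open>A\<close> encodes minimality of the norm; together
  with the normal equations it pins the vector down, so the pseudoinverse never has to be
  opened again.
\<close>

lemma mp_inverse_gram_iff:
  fixes A :: "real^'n^'m"
  shows "w = mp_inverse (A ** transpose A) ** A *v z \<longleftrightarrow>
    (\<exists>x. w = A *v x) \<and> A *v (transpose A *v w) = A *v z"
proof -
  let ?S = "A ** transpose A" and ?G = "mp_inverse (A ** transpose A)"
  have symS: "transpose ?S = ?S" by (simp add: matrix_transpose_mul)
  have G: "?S ** ?G ** ?S = ?S" "?G ** ?S ** ?G = ?G" "transpose (?G ** ?S) = ?G ** ?S"
    using mp_inverse_symmetric[OF symS] by (auto simp: is_mp_inverse_def)
  define g where "g = ?G ** A *v z"
  obtain w' where w': "A *v (transpose A *v w') = A *v z"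
    using normal_equations_solvable[of "transpose A" z] by auto
  have g_norm: "A *v (transpose A *v g) = A *v z"
  proof -
    have "A *v (transpose A *v g) = ?S *v (?G *v (?S *v w'))"
      using w' by (simp add: g_def matrix_vector_mul_assoc[symmetric])
    also have "\<dots> = ?S *v w'"
      using G(1) by (simp add: matrix_vector_mul_assoc matrix_mul_assoc)
    finally show ?thesis using w' by (simp add: matrix_vector_mul_assoc)
  qed
  have "?G ** ?S = ?S ** transpose ?G"
    using G(3) symS by (simp add: matrix_transpose_mul)
  then have "g = ?S ** transpose ?G ** ?G ** A *v z"
    using G(2) by (simp add: g_def)
  also have "\<dots> = A *v (transpose A ** transpose ?G ** ?G ** A *v z)"
    by (simp add: matrix_vector_mul_assoc matrix_mul_assoc)
  finally obtain xg where g_range: "g = A *v xg" by blast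
  have "w = g" if "w = A *v x" and "A *v (transpose A *v w) = A *v z" for x w
  proof -
    let ?e = "x - xg"
    have d: "w - g = A *v ?e" by (simp add: that g_range matrix_vector_mult_diff_distrib)
    have "A *v (transpose A *v (A *v ?e)) = 0"
      unfolding d[symmetric] using that(2) g_norm by (simp add: matrix_vector_mult_diff_distrib)
    then have "transpose A *v (A *v ?e) = 0"
      using gram_kernel[of "transpose A"] by simp
    then show ?thesis using gram_kernel[of A ?e] d by simp
  qed
  then show ?thesis
    using g_norm g_range unfolding g_def[symmetric] by blast
qed

lemma rect_pinv_full_rank:
  fixes X :: "real^'p^'n"
  assumes "rank X = CARD('p)"
  shows rect_pinv_left_inverse: "rect_pinv X ** X = mat 1"
    and rect_pinv_projection_symmetric: "transpose (X ** rect_pinv X) = X ** rect_pinv X"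
proof -
  let ?S = "transpose X ** X" and ?G = "mp_inverse (transpose X ** X)"
  have symS: "transpose ?S = ?S" by (simp add: matrix_transpose_mul)
  have inj: "v = 0" if "?S *v v = 0" for v
  proof -
    have "X *v v = 0"
      using that gram_kernel[of X v] by (simp add: matrix_vector_mul_assoc)
    moreover have "inj ((*v) X)" using assms by (simp add: full_rank_injective)
    ultimately show ?thesis by (metis injD matrix_vector_mult_0_right)
  qed
  have SGS: "?S ** ?G ** ?S = ?S" 
    using mp_inverse_symmetric[OF symS] by (auto simp: is_mp_inverse_def)
  have "(?G ** ?S) *v x = x" for x
  proof -
    have "?S *v ((?G ** ?S) *v x - x) = 0"
      using SGS by (simp add: matrix_vector_mult_diff_distrib matrix_vector_mul_assoc matrix_mul_assoc)
    then show ?thesis using inj by fastforce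
  qed
  then have GS: "?G ** ?S = mat 1" by (simp add: matrix_eq)
  then have "?S ** ?G = mat 1" by (simp add: matrix_left_right_inverse)
  then have "transpose ?G ** ?S = mat 1"
    using symS by (metis matrix_transpose_mul transpose_mat)
  then have "transpose ?G = ?G"
    by (metis \<open>?S ** ?G = mat 1\<close> matrix_mul_assoc matrix_mul_lid matrix_mul_rid)
  then show "transpose (X ** rect_pinv X) = X ** rect_pinv X"
    by (simp add: rect_pinv_def matrix_transpose_mul matrix_mul_assoc)
  show "rect_pinv X ** X = mat 1"
    using GS by (simp add: rect_pinv_def matrix_mul_assoc)
qed


section \<open>One linear piece of the path\<close>

abbreviation dual_grad :: "real^'n \<Rightarrow> real^'n^'m \<Rightarrow> real^'m \<Rightarrow> real^'m" where
  "dual_grad yt Dt p \<equiv> Dt *v (yt - transpose Dt *v p)"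

lemma rows_in_mult_nth: "(rows_in A S *v x) $ i = (if i \<in> S then (A *v x) $ i else 0)"
  by (simp add: rows_in_def matrix_vector_mul_component)

lemma transpose_rows_in_mult:
  "transpose (rows_in A S) *v w = transpose A *v (\<chi> i. if i \<in> S then w $ i else 0)"
  by (simp add: vec_eq_iff matrix_vector_mult_def transpose_def rows_in_def if_distrib
      if_distribR cong: if_cong)

lemma transpose_mult_split:
  "transpose A *v p = transpose (rows_in A S) *v p + transpose (rows_in A (-S)) *v p"
  by (simp add: transpose_rows_in_mult matrix_vector_right_distrib[symmetric])
     (rule arg_cong[where f="(*v) (transpose A)"], simp add: vec_eq_iff)

lemma coef_combine:
  "coef_a yt Dt B - l *\<^sub>R coef_b Dt B s =
     ls_pinv Dt B *v (yt - l *\<^sub>R (transpose (rows_in Dt B) *v s))"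
  by (simp add: coef_a_def coef_b_def matrix_vector_mult_diff_distrib matrix_vector_mult_scaleR)

lemma ls_pinv_iff:
  "w = ls_pinv Dt B *v z \<longleftrightarrow>
     (\<exists>x. w = rows_in Dt (-B) *v x) \<and>
     rows_in Dt (-B) *v (transpose (rows_in Dt (-B)) *v w) = rows_in Dt (-B) *v z"
  unfolding ls_pinv_def by (rule mp_inverse_gram_iff)

lemma path_piece_residual:
  "yt - transpose Dt *v path_piece yt Dt B s l =
     (yt - l *\<^sub>R (transpose (rows_in Dt B) *v s)) -
     transpose (rows_in Dt (-B)) *v (coef_a yt Dt B - l *\<^sub>R coef_b Dt B s)"
proof -
  have "transpose (rows_in Dt B) *v path_piece yt Dt B s l = transpose (rows_in Dt B) *v (l *\<^sub>R s)"
    by (simp only: transpose_rows_in_mult)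
       (rule arg_cong[where f="(*v) (transpose Dt)"], simp add: vec_eq_iff path_piece_def)
  moreover have "transpose (rows_in Dt (-B)) *v path_piece yt Dt B s l =
      transpose (rows_in Dt (-B)) *v (coef_a yt Dt B - l *\<^sub>R coef_b Dt B s)"
    by (simp only: transpose_rows_in_mult)
       (rule arg_cong[where f="(*v) (transpose Dt)"], simp add: vec_eq_iff path_piece_def)
  ultimately show ?thesis
    by (subst transpose_mult_split[of Dt _ B]) (simp add: matrix_vector_mult_scaleR)
qed

text \<open>
  The pseudoinverse formulas determine the piece by three conditions that are linear in \<open>p\<close>:
  prescribed boundary values, vanishing gradient at interior coordinates, and minimality of the
  norm in the form of a range condition. When \<open>B\<close> changes by one coordinate, each of them
  only has to be compared for that coordinate; this is what makes the pieces fit together.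
\<close>

lemma path_piece_iff:
  "p = path_piece yt Dt B s l \<longleftrightarrow>
     (\<forall>i\<in>B. p $ i = l * s $ i) \<and>
     (\<forall>i. i \<notin> B \<longrightarrow> dual_grad yt Dt p $ i = 0) \<and>
     (\<exists>x. \<forall>i. i \<notin> B \<longrightarrow> p $ i = (Dt *v x) $ i)" (is "_ \<longleftrightarrow> ?R p")
proof -
  let ?A = "rows_in Dt (-B)"
  let ?z = "yt - l *\<^sub>R (transpose (rows_in Dt B) *v s)"
  have eq: "p = path_piece yt Dt B s l \<longleftrightarrow>
      (\<forall>i\<in>B. p $ i = l * s $ i) \<and> (\<chi> i. if i \<in> -B then p $ i else 0) = ls_pinv Dt B *v ?z" for p
  proof -
    have "(ls_pinv Dt B *v z) $ i = 0" if "i \<in> B" for i z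
    proof -
      obtain x where "ls_pinv Dt B *v z = ?A *v x"
        using ls_pinv_iff[of "ls_pinv Dt B *v z" Dt B z] by blast
      then show ?thesis using that by (simp add: rows_in_mult_nth)
    qed
    then show ?thesis
      unfolding coef_combine[symmetric]
      by (auto simp: vec_eq_iff path_piece_def coef_a_def coef_b_def)
  qed
  show ?thesis
  proof (cases "\<forall>i\<in>B. p $ i = l * s $ i")
    case True
    let ?w = "\<chi> i. if i \<in> -B then p $ i else 0"
    have "transpose (rows_in Dt B) *v p = l *\<^sub>R (transpose (rows_in Dt B) *v s)"
      unfolding matrix_vector_mult_scaleR[symmetric] transpose_rows_in_mult
      by (rule arg_cong[where f="(*v) (transpose Dt)"]) (simp add: vec_eq_iff True)
    moreover have "transpose ?A *v p = transpose ?A *v ?w"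
      unfolding transpose_rows_in_mult
      by (rule arg_cong[where f="(*v) (transpose Dt)"]) (simp add: vec_eq_iff)
    ultimately have r: "yt - transpose Dt *v p = ?z - transpose ?A *v ?w"
      by (subst transpose_mult_split[of Dt _ B]) simp
    have "?A *v (transpose ?A *v ?w) = ?A *v ?z \<longleftrightarrow> ?A *v (yt - transpose Dt *v p) = 0"
      unfolding r matrix_vector_mult_diff_distrib[of ?A] by auto
    also have "\<dots> \<longleftrightarrow> (\<forall>i. i \<notin> B \<longrightarrow> dual_grad yt Dt p $ i = 0)"
      by (auto simp: vec_eq_iff rows_in_mult_nth)
    moreover have "(\<exists>x. ?w = ?A *v x) \<longleftrightarrow> (\<exists>x. \<forall>i. i \<notin> B \<longrightarrow> p $ i = (Dt *v x) $ i)"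
      by (auto simp: vec_eq_iff rows_in_mult_nth)
    ultimately show ?thesis
      unfolding eq ls_pinv_iff using True by auto
  qed (auto simp: eq)
qed

lemma path_piece_boundary: "i \<in> B \<Longrightarrow> path_piece yt Dt B s l $ i = l * s $ i"
  by (simp add: path_piece_def)

lemma path_piece_grad_interior: "i \<notin> B \<Longrightarrow> dual_grad yt Dt (path_piece yt Dt B s l) $ i = 0"
  using path_piece_iff by blast

lemma path_piece_affine:
  "\<exists>c v. \<forall>l. path_piece yt Dt B s l = c + l *\<^sub>R v"
proof -
  have "path_piece yt Dt B s l =
      (\<chi> i. if i \<in> B then 0 else coef_a yt Dt B $ i) +
      l *\<^sub>R (\<chi> i. if i \<in> B then s $ i else - coef_b Dt B s $ i)" for l
    by (simp add: vec_eq_iff path_piece_def)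
  then show ?thesis by blast
qed

text \<open>The leaving rule watches the gradient at the boundary coordinates, signed by \<open>s\<close>.\<close>

lemma signed_grad_eq:
  assumes "i \<in> B"
  shows "s $ i * dual_grad yt Dt (path_piece yt Dt B s l) $ i =
    coef_c yt Dt B s i - l * coef_d Dt B s i"
proof -
  let ?b = "transpose (rows_in Dt B) *v s"
  have proj: "resid_proj Dt B *v z = z - transpose (rows_in Dt (-B)) *v (ls_pinv Dt B *v z)" for z
    by (simp add: resid_proj_def matrix_vector_mult_diff_rdistrib matrix_vector_mul_assoc)
  have resid: "yt - transpose Dt *v path_piece yt Dt B s l =
      resid_proj Dt B *v yt - l *\<^sub>R (resid_proj Dt B *v ?b)"
    unfolding path_piece_residual coef_a_def coef_b_def proj
    by (simp add: matrix_vector_mult_diff_distrib matrix_vector_mult_scaleR algebra_simps)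
  show ?thesis
    unfolding resid using assms by (simp add: coef_c_def coef_d_def rows_in_mult_nth
        matrix_vector_mult_diff_distrib matrix_vector_mult_scaleR algebra_simps)
qed

text \<open>
  If the residual projection of \<open>yt\<close> is not orthogonal to row \<open>i\<close>, that row is independent of
  the interior rows. A coordinate that leaves the boundary can therefore take any value without
  disturbing the range condition.
\<close>

lemma coef_c_nonzero_independent:
  assumes "coef_c yt Dt B s i \<noteq> 0"
  obtains x where "\<And>j. j \<notin> B \<Longrightarrow> (Dt *v x) $ j = 0" and "(Dt *v x) $ i = 1"
proof -
  let ?A = "rows_in Dt (-B)"
  define r where "r = resid_proj Dt B *v yt"
  have nz: "i \<in> B" "(Dt *v r) $ i \<noteq> 0"
    using assms by (auto simp: coef_c_def rows_in_mult_nth r_def split: if_splits)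
  have "?A *v (transpose ?A *v (ls_pinv Dt B *v yt)) = ?A *v yt"
    using ls_pinv_iff by blast
  then have "?A *v r = 0"
    by (simp add: r_def resid_proj_def matrix_vector_mult_diff_rdistrib
        matrix_vector_mult_diff_distrib matrix_vector_mul_assoc)
  then have "(Dt *v r) $ j = 0" if "j \<notin> B" for j
    using that by (metis ComplI rows_in_mult_nth zero_index)
  then show thesis
    using nz by (intro that[of "(1 / (Dt *v r) $ i) *\<^sub>R r"])
      (simp_all add: matrix_vector_mult_scaleR)
qed


section \<open>Optimality\<close>

text \<open>
  First-order optimality in the box: the objective has gradient \<open>- dual_grad\<close>.
\<close>

definition dual_variational :: "real^'n \<Rightarrow> real^'n^'m \<Rightarrow> real \<Rightarrow> real^'m \<Rightarrow> bool" where
  "dual_variational yt Dt l p \<longleftrightarrow>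
     (\<forall>i. \<bar>p $ i\<bar> \<le> l) \<and> (\<forall>v. (\<forall>i. \<bar>v $ i\<bar> \<le> l) \<longrightarrow> dual_grad yt Dt p \<bullet> (v - p) \<le> 0)"

lemma infnorm_le_iff_cart: "infnorm (x :: real^'n) \<le> l \<longleftrightarrow> (\<forall>i. \<bar>x $ i\<bar> \<le> l)"
proof
  assume "\<forall>i. \<bar>x $ i\<bar> \<le> l"
  then show "infnorm x \<le> l" unfolding infnorm_cart by (intro cSup_least) auto
qed (meson component_le_infnorm_cart order_trans)

lemma dual_variational_imp_solution:
  fixes Dt :: "real^'n^'m"
  assumes "dual_variational yt Dt l p"
  shows "dual_solution yt Dt l p"
  unfolding dual_solution_def is_arg_min_linorder infnorm_le_iff_cart
proof (intro conjI allI impI)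
  show "\<bar>p $ i\<bar> \<le> l" for i using assms by (simp add: dual_variational_def)
next
  fix v :: "real^'m" assume v: "\<forall>i. \<bar>v $ i\<bar> \<le> l"
  let ?r = "yt - transpose Dt *v p" and ?e = "transpose Dt *v (v - p)"
  have "?r \<bullet> ?e = dual_grad yt Dt p \<bullet> (v - p)"
    by (simp add: inner_matrix_vector_transpose)
  also have "\<dots> \<le> 0" using assms v by (simp add: dual_variational_def)
  finally have le: "?r \<bullet> ?e \<le> 0" .
  have sq: "(norm (a - b))\<^sup>2 = (norm a)\<^sup>2 - 2 * (a \<bullet> b) + (norm b)\<^sup>2" for a b :: "real^'n"
    by (simp add: power2_norm_eq_inner inner_diff inner_commute)
  have gen: "1/2 * a \<le> 1/2 * (a - 2 * b + c)" if "b \<le> 0" "0 \<le> c" for a b c :: real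
    using that by simp
  have v_eq: "yt - transpose Dt *v v = ?r - ?e"
    by (simp add: matrix_vector_mult_diff_distrib)
  show "1/2 * (norm ?r)\<^sup>2 \<le> 1/2 * (norm (yt - transpose Dt *v v))\<^sup>2"
    unfolding v_eq sq[of ?r ?e] by (rule gen[OF le zero_le_power2])
qed

definition piece_valid ::
    "real^'n \<Rightarrow> real^'n^'m \<Rightarrow> 'm set \<Rightarrow> real^'m \<Rightarrow> real \<Rightarrow> bool" where
  "piece_valid yt Dt B s l \<longleftrightarrow>
     (\<forall>i. \<bar>path_piece yt Dt B s l $ i\<bar> \<le> l) \<and>
     (\<forall>i\<in>B. 0 \<le> s $ i * dual_grad yt Dt (path_piece yt Dt B s l) $ i)"

lemma piece_valid_imp_variational:
  fixes Dt :: "real^'n^'m"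
  assumes sgn: "\<And>i. i \<in> B \<Longrightarrow> s $ i \<in> {1, -1}" and val: "piece_valid yt Dt B s l"
  shows "dual_variational yt Dt l (path_piece yt Dt B s l)"
  unfolding dual_variational_def
proof (intro conjI allI impI)
  let ?p = "path_piece yt Dt B s l" and ?g = "dual_grad yt Dt (path_piece yt Dt B s l)"
  show "\<bar>?p $ i\<bar> \<le> l" for i using val by (simp add: piece_valid_def)
  fix v :: "real^'m" assume v: "\<forall>i. \<bar>v $ i\<bar> \<le> l"
  have "?g $ i * (v $ i - ?p $ i) \<le> 0" for i
  proof (cases "i \<in> B")
    case True
    have "0 \<le> s $ i * ?g $ i" using val True by (simp add: piece_valid_def)
    moreover have "s $ i * (v $ i - ?p $ i) \<le> 0"
      using sgn[OF True] v[rule_format, of i] by (auto simp: path_piece_boundary[OF True])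
    ultimately show ?thesis
      using sgn[OF True] by (auto simp: mult_nonneg_nonpos mult_nonpos_nonneg)
  qed (simp add: path_piece_grad_interior)
  then show "?g \<bullet> (v - ?p) \<le> 0"
    by (simp add: inner_vec_def sum_nonpos)
qed

text \<open>
  Moving only coordinate \<open>i\<close> of a solution from the boundary to the centre shows that the
  gradient sign conditions are also necessary. This is used to see that a piece is abandoned
  because it really stops being optimal.
\<close>

lemma dual_variational_boundary_sign:
  assumes opt: "dual_variational yt Dt l p" and "0 < l" and "p $ i = l * \<sigma>"
  shows "0 \<le> \<sigma> * dual_grad yt Dt p $ i"
proof -
  define v where "v = (\<chi> j. if j = i then 0 else p $ j)"
  have "\<forall>j. \<bar>v $ j\<bar> \<le> l"
    using opt \<open>0 < l\<close> by (simp add: v_def dual_variational_def)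
  then have "dual_grad yt Dt p \<bullet> (v - p) \<le> 0"
    using opt by (simp add: dual_variational_def)
  also have "v - p = - (l * \<sigma>) *\<^sub>R axis i 1"
    using assms(3) by (simp add: vec_eq_iff v_def axis_def)
  finally have "0 \<le> l * (\<sigma> * dual_grad yt Dt p $ i)"
    by (simp add: inner_axis mult.assoc)
  then show ?thesis using \<open>0 < l\<close> by (simp add: zero_le_mult_iff)
qed


section \<open>One step of the algorithm\<close>

lemma hit_time_upper_bound:
  fixes a b t x z :: real
  assumes "b + \<sigma> \<noteq> 0" "t = a / (b + \<sigma>)" "\<sigma> \<in> {1, -1}" "0 \<le> t" "t \<le> x" "x \<le> z"
    and z: "a - z * b \<le> z"
  shows "a - x * b \<le> x"
proof (rule ccontr)
  assume "\<not> a - x * b \<le> x"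
  then have gt: "a > x * (b + 1)" by (simp add: algebra_simps)
  have le: "a \<le> z * (b + 1)" using z by (simp add: algebra_simps)
  have "0 < (z - x) * (b + 1)" using gt le by (simp add: algebra_simps)
  then have pos: "b + 1 > 0" using \<open>x \<le> z\<close> by (simp add: zero_less_mult_iff)
  have "0 \<le> x * (b + 1)" using assms(4,5) pos by simp
  then have a: "a > 0" using gt by simp
  have at: "a = t * (b + \<sigma>)" using assms by simp
  show False
  proof (cases "\<sigma> = 1")
    case True
    have "t * (b + 1) \<le> x * (b + 1)" using pos assms(5) by (simp add: mult_right_mono)
    then show False using at gt True by simp
  next
    case False
    then have s: "\<sigma> = -1" using assms by simp
    then have "b - 1 > 0" using at a assms(4) by (simp add: zero_less_mult_iff)
    then have "a \<le> x * (b - 1)" using at s assms(5) by (simp add: mult_right_mono)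
    also have "\<dots> \<le> x * (b + 1)" using assms(4,5) by (intro mult_left_mono) auto
    finally show False using gt by simp
  qed
qed

text \<open>
  An interior coordinate that is feasible at the start of a piece stays feasible down to any
  admissible hitting time \<open>t\<close>: if it left the box above \<open>t\<close>, the crossing value would exceed \<open>t\<close>,
  and the candidate for the other sign is then either negative or larger still.
\<close>

lemma hit_time_feasible:
  assumes hit: "is_hit_time lk a b t" and "t \<le> x" "ereal x \<le> lk"
    and start: "lk = \<infinity> \<and> b = 0 \<or> (\<exists>z. lk = ereal z \<and> \<bar>a - z * b\<bar> \<le> z)"
  shows "\<bar>a - x * b\<bar> \<le> x"
proof -
  obtain \<sigma> where \<sigma>: "\<sigma> \<in> {1, -1}" "b + \<sigma> \<noteq> 0" "t = a / (b + \<sigma>)" and t: "0 \<le> t"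
    using hit unfolding is_hit_time_def by blast
  from start show ?thesis
  proof
    assume "lk = \<infinity> \<and> b = 0"
    then show ?thesis using \<sigma> t \<open>t \<le> x\<close> by auto
  next
    assume "\<exists>z. lk = ereal z \<and> \<bar>a - z * b\<bar> \<le> z"
    then obtain z where z: "x \<le> z" "\<bar>a - z * b\<bar> \<le> z" using assms(3) by auto
    have up: "a - x * b \<le> x"
      using hit_time_upper_bound[OF \<sigma>(2,3,1) t \<open>t \<le> x\<close> z(1)] z(2) by simp
    have "- b + - \<sigma> = - (b + \<sigma>)" by simp
    then have "- b + - \<sigma> \<noteq> 0" "t = - a / (- b + - \<sigma>)" "- \<sigma> \<in> {1, -1}"
      using \<sigma> by (simp_all only: minus_divide_divide) auto
    from hit_time_upper_bound[OF this t \<open>t \<le> x\<close> z(1)] z(2)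
    have "- a + x * b \<le> x" by simp
    then show ?thesis using up by (simp add: abs_le_iff)
  qed
qed

text \<open>
  A line that is feasible somewhere above the hitting value and meets the boundary there with a
  different slope must cross it.
\<close>

lemma hit_crosses_outward:
  fixes a b x z l :: real
  assumes "\<sigma> \<in> {1, -1}" "b + \<sigma> \<noteq> 0" "a = x * (b + \<sigma>)" "x < z" "\<bar>a - z * b\<bar> \<le> z" "l < x"
  shows "\<not> \<bar>a - l * b\<bar> \<le> l"
proof -
  define e where "e = \<sigma> * b + 1"
  have e: "e \<noteq> 0" using assms(1,2) by (auto simp: e_def)
  have "\<sigma> * (a - z * b) = z + (x - z) * e" "\<sigma> * (a - l * b) = l + (x - l) * e"
    using assms(1,3) by (auto simp: e_def algebra_simps)
  moreover have "\<sigma> * (a - z * b) \<le> z" using assms(1,5) by auto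
  ultimately have "(z - x) * e \<ge> 0" by (simp add: algebra_simps)
  then have "e > 0" using \<open>x < z\<close> e by (simp add: zero_le_mult_iff)
  then have "(x - l) * e > 0" using \<open>l < x\<close> by simp
  then have "\<sigma> * (a - l * b) > l"
    using \<open>\<sigma> * (a - l * b) = l + (x - l) * e\<close> by simp
  then show ?thesis using assms(1) by auto
qed

lemma max_or_zero_ge: "finite S \<Longrightarrow> i \<in> S \<Longrightarrow> f i \<le> max_or_zero f S"
  by (auto simp: max_or_zero_def)

lemma max_or_zero_cases:
  assumes "finite S"
  obtains "S = {}" "max_or_zero f S = 0" | i where "i \<in> S" "max_or_zero f S = f i"
proof (cases "S = {}")
  case False
  then have "Max (f ` S) \<in> f ` S" using assms by (intro Max_in) auto
  with False that(2) show thesis by (auto simp: max_or_zero_def)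
qed (auto simp: max_or_zero_def intro: that)

text \<open>
  The loop invariant. At \<open>\<infinity>\<close> there is no vector whose validity could be stated; with \<open>B\<close> empty the
  piece is constant, so that the hitting times alone control it.
\<close>

definition entry_valid ::
    "real^'n \<Rightarrow> real^'n^'m \<Rightarrow> ereal \<Rightarrow> 'm set \<Rightarrow> real^'m \<Rightarrow> bool" where
  "entry_valid yt Dt lk B s \<longleftrightarrow>
     (\<forall>i\<in>B. s $ i \<in> {1, -1}) \<and>
     (lk = \<infinity> \<and> B = {} \<or> (\<exists>z. lk = ereal z \<and> piece_valid yt Dt B s z))"

lemma path_piece_interior:
  "i \<notin> B \<Longrightarrow> path_piece yt Dt B s l $ i = coef_a yt Dt B $ i - l * coef_b Dt B s $ i"
  by (simp add: path_piece_def)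

lemma coef_b_empty: "coef_b Dt {} s = 0"
proof -
  have "rows_in Dt {} = 0" by (simp add: rows_in_def vec_eq_iff)
  then show ?thesis by (simp add: coef_b_def transpose_def vec_eq_iff matrix_vector_mult_def)
qed

lemma piece_valid_signed_grad:
  assumes "piece_valid yt Dt B s l" and "i \<in> B"
  shows "0 \<le> coef_c yt Dt B s i - l * coef_d Dt B s i"
  using assms unfolding signed_grad_eq[OF assms(2), symmetric] by (simp add: piece_valid_def)

text \<open>
  The bound does not come from the formula for the leaving time but from the gradient sign at the
  start of the piece.
\<close>

lemma leave_time_le:
  assumes entry: "entry_valid yt Dt lk B s" and "0 \<le> lk" and "i \<in> B"
  shows "ereal (leave_time yt Dt B s i) \<le> lk"
proof -
  obtain z where z: "lk = ereal z" "piece_valid yt Dt B s z"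
    using entry \<open>i \<in> B\<close> by (auto simp: entry_valid_def)
  then have "0 \<le> coef_c yt Dt B s i - z * coef_d Dt B s i"
    using piece_valid_signed_grad \<open>i \<in> B\<close> by blast
  then show ?thesis
    using z \<open>0 \<le> lk\<close> by (auto simp: leave_time_def divide_simps)
qed

lemma leave_time_nonneg: "0 \<le> leave_time yt Dt B s i"
  by (simp add: leave_time_def divide_nonpos_neg)

text \<open>
  Validity propagates from the entry of a piece to the next event: hitting times guard the box
  constraints, leaving times guard the gradient signs.
\<close>

lemma piece_valid_until_event:
  assumes entry: "entry_valid yt Dt lk B s"
    and hits: "\<And>i. i \<notin> B \<Longrightarrow> is_hit_time lk (coef_a yt Dt B $ i) (coef_b Dt B s $ i) (t i)"
    and "0 \<le> x" "ereal x \<le> lk"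
    and tx: "\<And>i. i \<notin> B \<Longrightarrow> t i \<le> x" and lx: "\<And>i. i \<in> B \<Longrightarrow> leave_time yt Dt B s i \<le> x"
  shows "piece_valid yt Dt B s x"
  unfolding piece_valid_def
proof (intro conjI allI ballI)
  fix i
  show "\<bar>path_piece yt Dt B s x $ i\<bar> \<le> x"
  proof (cases "i \<in> B")
    case True
    then have "s $ i \<in> {1, -1}" using entry by (auto simp: entry_valid_def)
    then show ?thesis using \<open>0 \<le> x\<close> by (auto simp: path_piece_boundary[OF True])
  next
    case False
    have "lk = \<infinity> \<and> coef_b Dt B s $ i = 0 \<or>
        (\<exists>z. lk = ereal z \<and> \<bar>coef_a yt Dt B $ i - z * coef_b Dt B s $ i\<bar> \<le> z)"
    proof (cases "lk = \<infinity>")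
      case True
      then have "B = {}" using entry by (auto simp: entry_valid_def)
      then show ?thesis using True by (simp add: coef_b_empty)
    next
      case False
      then obtain z where "lk = ereal z" "piece_valid yt Dt B s z"
        using entry by (auto simp: entry_valid_def)
      then show ?thesis
        unfolding path_piece_interior[OF \<open>i \<notin> B\<close>, symmetric] by (auto simp: piece_valid_def)
    qed
    then show ?thesis
      using hit_time_feasible[OF hits[OF False] tx[OF False] \<open>ereal x \<le> lk\<close>]
      by (simp add: path_piece_interior[OF False])
  qed
next
  fix i assume i: "i \<in> B"
  let ?c = "coef_c yt Dt B s i" and ?d = "coef_d Dt B s i"
  obtain z where z: "lk = ereal z" "piece_valid yt Dt B s z" and "x \<le> z"
    using entry i \<open>ereal x \<le> lk\<close> by (auto simp: entry_valid_def)
  then have cz: "0 \<le> ?c - z * ?d"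
    using piece_valid_signed_grad i by blast
  show "0 \<le> s $ i * dual_grad yt Dt (path_piece yt Dt B s x) $ i"
    unfolding signed_grad_eq[OF i]
  proof (rule ccontr)
    assume "\<not> 0 \<le> ?c - x * ?d"
    then have cx: "?c < x * ?d" by simp
    then have "(z - x) * ?d < 0" using cz by (simp add: algebra_simps)
    then have d: "?d < 0" using \<open>x \<le> z\<close> by (simp add: mult_less_0_iff)
    then have "x * ?d \<le> 0" using \<open>0 \<le> x\<close> by (simp add: mult_nonneg_nonpos)
    then have "?c < 0" using cx by simp
    then show False
      using lx[OF i] d cx by (simp add: leave_time_def divide_simps)
  qed
qed

text \<open>
  The last conclusion makes every event a genuine kink. It is claimed only when the piece has
  positive length: a coordinate that has just left the boundary may be readmitted at once, and
  such an event does not by itself end the optimality of the piece before it.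
\<close>

lemma dual_step_correct:
  assumes entry: "entry_valid yt Dt lk B s" and "0 < lk"
    and step: "dual_step yt Dt lk B s lk' B' s'"
  obtains x where "lk' = ereal x" "0 \<le> x" "ereal x \<le> lk"
    and "\<And>l. x \<le> l \<Longrightarrow> ereal l \<le> lk \<Longrightarrow> piece_valid yt Dt B s l"
    and "0 < x \<Longrightarrow> path_piece yt Dt B' s' x = path_piece yt Dt B s x"
    and "0 < x \<Longrightarrow> entry_valid yt Dt lk' B' s'"
    and "\<And>l. ereal x < lk \<Longrightarrow> 0 < l \<Longrightarrow> l < x \<Longrightarrow>
      \<not> dual_variational yt Dt l (path_piece yt Dt B s l)"
proof -
  let ?P = "path_piece yt Dt B s"
  obtain t h l where
    hits': "\<forall>i\<in>-B. is_hit_time lk (coef_a yt Dt B $ i) (coef_b Dt B s $ i) (t i)"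
    and h: "h = max_or_zero t (-B)" and l: "l = max_or_zero (leave_time yt Dt B s) B"
    and lk': "lk' = ereal (max h l)"
    and upd: "if h > l then
           \<exists>i\<in>-B. t i = h \<and> B' = insert i B \<and>
             s' = (\<chi> j. if j = i then sgn (?P (max h l) $ i) else s $ j)
         else if B = {} then B' = B \<and> s' = s
         else
           \<exists>i\<in>B. leave_time yt Dt B s i = l \<and> B' = B - {i} \<and>
             s' = (\<chi> j. if j = i then 0 else s $ j)"
    using step unfolding dual_step_def by (elim exE conjE) (rule that)
  have hits: "is_hit_time lk (coef_a yt Dt B $ i) (coef_b Dt B s $ i) (t i)" if "i \<notin> B" for i
    using hits' that by simp
  have sgn: "\<And>i. i \<in> B \<Longrightarrow> s $ i \<in> {1, -1}" using entry by (auto simp: entry_valid_def)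
  have "0 \<le> h \<and> ereal h \<le> lk"
  proof (cases rule: max_or_zero_cases[of "-B" t, OF finite])
    case (2 i)
    then show ?thesis using hits[of i] by (simp add: h is_hit_time_def)
  qed (use \<open>0 < lk\<close> in \<open>simp_all add: h zero_ereal_def[symmetric] less_imp_le\<close>)
  then have h_le: "0 \<le> h" "ereal h \<le> lk" by auto
  have "0 \<le> l \<and> ereal l \<le> lk"
  proof (cases rule: max_or_zero_cases[of B "leave_time yt Dt B s", OF finite])
    case (2 i)
    then show ?thesis
      using leave_time_nonneg leave_time_le[OF entry] \<open>0 < lk\<close> by (simp add: l less_imp_le)
  qed (use \<open>0 < lk\<close> in \<open>simp_all add: l zero_ereal_def[symmetric] less_imp_le\<close>)
  then have l_le: "0 \<le> l" "ereal l \<le> lk" by auto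
  define x where "x = max h l"
  have mx: "max h l = x" and lk'x: "lk' = ereal x" using lk' by (simp_all only: x_def)
  have x: "0 \<le> x" "ereal x \<le> lk" "h \<le> x" "l \<le> x"
    using h_le l_le by (auto simp: x_def max_def)
  have tx: "t i \<le> x" if "i \<notin> B" for i
    using max_or_zero_ge[of "-B" i t] that x(3) by (simp add: h)
  have lx: "leave_time yt Dt B s i \<le> x" if "i \<in> B" for i
    using max_or_zero_ge[of B i "leave_time yt Dt B s"] that x(4) by (simp add: l)
  have valid: "piece_valid yt Dt B s y" if "x \<le> y" "ereal y \<le> lk" for y
  proof (rule piece_valid_until_event[OF entry hits _ that(2)])
    show "0 \<le> y" using x(1) that(1) by simp
    show "t i \<le> y" if "i \<notin> B" for i using tx[OF that] \<open>x \<le> y\<close> by simp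
    show "leave_time yt Dt B s i \<le> y" if "i \<in> B" for i using lx[OF that] \<open>x \<le> y\<close> by simp
  qed
  have P: "(\<forall>i\<in>B. ?P x $ i = x * s $ i)" "(\<forall>i. i \<notin> B \<longrightarrow> dual_grad yt Dt (?P x) $ i = 0)"
    "\<exists>w. \<forall>i. i \<notin> B \<longrightarrow> ?P x $ i = (Dt *v w) $ i"
    using path_piece_iff by blast+
  have main: "?P x = path_piece yt Dt B' s' x \<and> entry_valid yt Dt lk' B' s' \<and>
      (\<forall>y. ereal x < lk \<longrightarrow> 0 < y \<longrightarrow> y < x \<longrightarrow> \<not> dual_variational yt Dt y (?P y))" if "0 < x"
  proof (cases "h > l")
    case True
    then have xh: "x = h" by (simp add: x_def)
    obtain i where i: "i \<notin> B" "t i = x" "B' = insert i B"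
        and s': "s' = (\<chi> j. if j = i then sgn (?P x $ i) else s $ j)"
      using upd True unfolding mx by (auto simp: xh)
    let ?a = "coef_a yt Dt B $ i" and ?b = "coef_b Dt B s $ i"
    obtain \<sigma> where \<sigma>1: "\<sigma> \<in> {1, -1}" "?b + \<sigma> \<noteq> 0" "t i = ?a / (?b + \<sigma>)"
      using hits[OF i(1)] unfolding is_hit_time_def by blast
    then have \<sigma>: "\<sigma> \<in> {1, -1}" "?b + \<sigma> \<noteq> 0" "?a = x * (?b + \<sigma>)"
      using i(2) by auto
    have Pi: "?P x $ i = x * \<sigma>"
      using \<sigma>(3) by (simp add: path_piece_interior[OF i(1)] algebra_simps)
    have s'i: "s' $ i = \<sigma>"
      using \<open>0 < x\<close> \<sigma>(1) by (auto simp: s' Pi sgn_mult)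
    have s'B: "s' $ j = s $ j" if "j \<in> B" for j using that i(1) by (auto simp: s')
    have piece: "?P x = path_piece yt Dt B' s' x"
      unfolding path_piece_iff using P Pi s'i s'B i(3) by auto
    have "piece_valid yt Dt B' s' x"
      using valid[OF order_refl x(2)] P(2) i s'B
      unfolding piece_valid_def piece[symmetric] by auto
    then have "entry_valid yt Dt lk' B' s'"
      using sgn s'i s'B \<sigma>(1) i(3) by (auto simp: entry_valid_def lk'x)
    moreover have "\<not> dual_variational yt Dt y (?P y)" if y: "ereal x < lk" "0 < y" "y < x" for y
    proof -
      \<comment> \<open>any second feasible point of the piece; \<open>lk\<close> itself may be infinite\<close>
      obtain z where z: "x < z" "ereal z \<le> lk"
      proof (cases lk)
        case (real r)
        then show thesis using that[of r] y(1) by simp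
      qed (use y(1) that[of "x + 1"] in auto)
      then have "\<bar>?P z $ i\<bar> \<le> z" using valid[of z] by (simp add: piece_valid_def)
      then have "\<not> \<bar>?P y $ i\<bar> \<le> y"
        using hit_crosses_outward[OF \<sigma> z(1) _ y(3)] by (simp add: path_piece_interior[OF i(1)])
      then show ?thesis by (auto simp: dual_variational_def)
    qed
    ultimately show ?thesis by (intro conjI allI impI piece)
  next
    case False
    then have xl: "x = l" by (simp add: x_def)
    then have "B \<noteq> {}" using \<open>0 < x\<close> by (auto simp: l max_or_zero_def)
    then obtain i where i: "i \<in> B" "leave_time yt Dt B s i = x" "B' = B - {i}"
        and s': "s' = (\<chi> j. if j = i then 0 else s $ j)"
      using upd False unfolding mx by (auto simp: xl)
    let ?c = "coef_c yt Dt B s i" and ?d = "coef_d Dt B s i"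
    have cd: "?c < 0" "?d < 0" "?c = x * ?d"
      using i(2) \<open>0 < x\<close> by (auto simp: leave_time_def split: if_splits)
    have s'B: "s' $ j = s $ j" if "j \<in> B'" for j using that i(3) by (auto simp: s')
    have gi: "dual_grad yt Dt (?P x) $ i = 0"
      using signed_grad_eq[OF i(1), of s Dt yt x] cd(3) sgn[OF i(1)] by auto
    obtain r where r: "\<And>j. j \<notin> B \<Longrightarrow> (Dt *v r) $ j = 0" "(Dt *v r) $ i = 1"
      using cd(1) by (blast intro: coef_c_nonzero_independent[OF less_imp_neq])
    obtain w where w: "\<And>j. j \<notin> B \<Longrightarrow> ?P x $ j = (Dt *v w) $ j" using P(3) by blast
    \<comment> \<open>\<open>r\<close> moves coordinate \<open>i\<close> of the range vector to the required value and no interior one\<close>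
    have range: "?P x $ j = (Dt *v (w + (?P x $ i - (Dt *v w) $ i) *\<^sub>R r)) $ j" if "j \<notin> B'" for j
      using that i(3) r w[of j]
      by (cases "j = i") (simp_all add: matrix_vector_right_distrib matrix_vector_mult_scaleR)
    have piece: "?P x = path_piece yt Dt B' s' x"
      unfolding path_piece_iff
    proof (intro conjI)
      show "\<exists>w. \<forall>j. j \<notin> B' \<longrightarrow> ?P x $ j = (Dt *v w) $ j" using range by blast
    qed (use P(1,2) gi s'B i(3) in auto)
    have "piece_valid yt Dt B' s' x"
      using valid[OF order_refl x(2)] i s'B
      unfolding piece_valid_def piece[symmetric] by auto
    then have "entry_valid yt Dt lk' B' s'"
      using sgn s'B i(3) by (auto simp: entry_valid_def lk'x)
    moreover have "\<not> dual_variational yt Dt y (?P y)" if y: "ereal x < lk" "0 < y" "y < x" for y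
    proof
      assume "dual_variational yt Dt y (?P y)"
      then have "0 \<le> ?c - y * ?d"
        unfolding signed_grad_eq[OF i(1), symmetric]
        by (rule dual_variational_boundary_sign[OF _ y(2) path_piece_boundary[OF i(1)]])
      moreover have "x * ?d < y * ?d" using y(3) cd(2) by simp
      ultimately show False using cd(3) by simp
    qed
    ultimately show ?thesis by (intro conjI allI impI piece)
  qed
  show thesis
  proof (rule that[OF lk'x x(1,2) valid])
    show "path_piece yt Dt B' s' x = ?P x" if "0 < x" using main[OF that] by (elim conjE) (rule sym)
    show "entry_valid yt Dt lk' B' s'" if "0 < x" using main[OF that] by (elim conjE)
    show "\<not> dual_variational yt Dt y (?P y)" if "ereal x < lk" "0 < y" "y < x" for y
      using main[OF less_trans[OF that(2,3)]] that by blast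
  qed
qed


section \<open>The whole path\<close>

lemma finite_visited: "finite (visited T lam)"
proof -
  have "visited T lam = ereal -` (lam ` {1..T})" by (auto simp: visited_def)
  then show ?thesis by (simp add: finite_vimageI inj_on_def)
qed

context
  fixes yt :: "real^'n" and Dt :: "real^'n^'m" and T lam B s
  assumes run: "dual_path_run yt Dt T lam B s"
begin

abbreviation "piece k \<equiv> path_piece yt Dt (B k) (s k)"

lemma run_start: "lam 0 = \<infinity>"
  using run by (simp add: dual_path_run_def)

lemma run_step:
  "k < T \<Longrightarrow> 0 < lam k"
  "k < T \<Longrightarrow> dual_step yt Dt (lam k) (B k) (s k) (lam (Suc k)) (B (Suc k)) (s (Suc k))"
  using run by (auto simp: dual_path_run_def)

lemma run_entry_valid: "k < T \<Longrightarrow> entry_valid yt Dt (lam k) (B k) (s k)"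
proof (induction k)
  case 0
  then show ?case using run by (simp add: dual_path_run_def entry_valid_def)
next
  case (Suc k)
  then have k: "k < T" by simp
  show ?case
    using run_step(1)[OF Suc.prems]
    by - (rule dual_step_correct[OF Suc.IH[OF k] run_step[OF k]], simp)
qed

lemma run_facts:
  assumes "k < T"
  shows run_next: "\<exists>x. lam (Suc k) = ereal x \<and> 0 \<le> x"
    and run_decreasing: "lam (Suc k) \<le> lam k"
    and run_variational:
      "\<And>l. lam (Suc k) \<le> ereal l \<Longrightarrow> ereal l \<le> lam k \<Longrightarrow> dual_variational yt Dt l (piece k l)"
    and run_match: "\<And>x. lam (Suc k) = ereal x \<Longrightarrow> 0 < x \<Longrightarrow> piece (Suc k) x = piece k x"
    and run_exit: "\<And>x l. lam (Suc k) = ereal x \<Longrightarrow> ereal x < lam k \<Longrightarrow> 0 < l \<Longrightarrow> l < x \<Longrightarrow>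
      \<not> dual_variational yt Dt l (piece k l)"
proof -
  note entry = run_entry_valid[OF assms]
  have sgn: "i \<in> B k \<Longrightarrow> s k $ i \<in> {1, -1}" for i using entry by (auto simp: entry_valid_def)
  obtain x where x: "lam (Suc k) = ereal x" "0 \<le> x" "ereal x \<le> lam k"
    and valid: "\<And>l. x \<le> l \<Longrightarrow> ereal l \<le> lam k \<Longrightarrow> piece_valid yt Dt (B k) (s k) l"
    and rest: "0 < x \<Longrightarrow> piece (Suc k) x = piece k x"
    "\<And>l. ereal x < lam k \<Longrightarrow> 0 < l \<Longrightarrow> l < x \<Longrightarrow> \<not> dual_variational yt Dt l (piece k l)"
    by (rule dual_step_correct[OF entry run_step[OF assms]]) (rule that)
  show "\<exists>x. lam (Suc k) = ereal x \<and> 0 \<le> x" "lam (Suc k) \<le> lam k" using x by auto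
  show "dual_variational yt Dt l (piece k l)" if "lam (Suc k) \<le> ereal l" "ereal l \<le> lam k" for l
    using that x(1) by (intro piece_valid_imp_variational sgn valid) auto
  show "piece (Suc k) z = piece k z" if "lam (Suc k) = ereal z" "0 < z" for z
    using that x(1) rest(1) by simp
  show "\<not> dual_variational yt Dt l (piece k l)"
    if "lam (Suc k) = ereal z" "ereal z < lam k" "0 < l" "l < z" for z l
    using that x(1) rest(2) by simp
qed

lemma run_antimono:
  assumes "i \<le> j" "j \<le> T"
  shows "lam j \<le> lam i"
  using assms
proof (induction rule: dec_induct)
  case (step k)
  then show ?case using run_decreasing[of k] by simp
qed simp

lemma run_end: "0 < T" "lam T = 0"
proof -
  show "0 < T" using run by (cases T) (auto simp: dual_path_run_def)
  then obtain x where "lam T = ereal x" "0 \<le> x" using run_next[of "T - 1"] by auto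
  moreover have "\<not> 0 < lam T" using run by (simp add: dual_path_run_def)
  ultimately show "lam T = 0" by (simp add: zero_ereal_def)
qed

text \<open>
  Two different pieces share a value only if all events between them happen at that value, so the
  agreement of consecutive pieces can be chained. Hence it does not matter which piece the path
  uses at a breakpoint.
\<close>

lemma run_pieces_agree:
  assumes "i \<le> j" "j < T" "lam (Suc i) \<le> ereal x" "ereal x \<le> lam j"
  shows "piece j x = piece i x"
  using assms(1,2,4)
proof (induction rule: dec_induct)
  case (step k)
  have "lam (Suc k) \<le> lam (Suc i)" using step by (intro run_antimono) auto
  then have eq: "lam (Suc k) = ereal x" using step.prems assms(3) by simp
  have k: "k < T" using step by simp
  have "0 < x" using run_step(1)[OF step.prems(1)] eq by simp
  then have "piece (Suc k) x = piece k x"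
    by (rule run_match[OF k eq])
  moreover have "ereal x \<le> lam k"
    using run_antimono[of k "Suc k"] k eq by simp
  ultimately show ?case using step.IH k by simp
qed simp

text \<open>
  Crossing \<open>x\<close>, the path changes from the last piece that starts strictly above \<open>x\<close> to the first one
  that continues strictly below it; the pieces between them have length zero.
\<close>

lemma run_event_neighbours:
  assumes "x \<in> visited T lam" "0 < x"
  obtains i j where "i < j" "j < T" "lam (Suc i) = ereal x" "ereal x < lam i"
    "lam j = ereal x" "lam (Suc j) < ereal x"
proof -
  let ?Q = "\<lambda>k. k \<le> T \<and> lam k = ereal x"
  obtain m where m: "?Q m" using assms(1) unfolding visited_def by auto
  define i' where "i' = (LEAST k. ?Q k)"
  have i': "?Q i'" unfolding i'_def using m by (rule LeastI)
  have i'_least: "\<not> ?Q k" if "k < i'" for k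
    using that unfolding i'_def by (rule not_less_Least)
  have "i' \<noteq> 0"
  proof
    assume "i' = 0"
    then show False using i' run_start by simp
  qed
  then obtain i where i: "i' = Suc i" using not0_implies_Suc by blast
  have lam_i: "lam (Suc i) = ereal x" and "i < T" using i' i by simp_all
  have "ereal x < lam i"
  proof (rule le_neq_trans)
    show "ereal x \<le> lam i" using run_antimono[of i "Suc i"] \<open>i < T\<close> by (simp add: lam_i)
    show "ereal x \<noteq> lam i" using i'_least[of i] i \<open>i < T\<close> by force
  qed
  define j where "j = (GREATEST k. ?Q k)"
  have j: "?Q j" unfolding j_def using m by (rule GreatestI_nat[where b = T]) simp
  have j_greatest: "k \<le> j" if "?Q k" for k
    unfolding j_def using that by (rule Greatest_le_nat[where b = T]) simp
  have "j \<noteq> T"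
  proof
    assume "j = T"
    then show False using j run_end(2) assms(2) by simp
  qed
  then have "j < T" using j by simp
  have "lam (Suc j) < ereal x"
  proof (rule le_neq_trans)
    show "lam (Suc j) \<le> ereal x" using run_antimono[of j "Suc j"] \<open>j < T\<close> j by simp
    show "lam (Suc j) \<noteq> ereal x" using j_greatest[of "Suc j"] \<open>j < T\<close> by auto
  qed
  moreover have "i < j" using j_greatest[of i'] i' i by simp
  ultimately show thesis
    by (intro that[OF _ \<open>j < T\<close> lam_i \<open>ereal x < lam i\<close>]) (simp_all add: j)
qed

context
  fixes u :: "real \<Rightarrow> real^'m"
  assumes path: "is_dual_path yt Dt T lam B s u"
begin

lemma path_eq_piece:
  assumes k: "k < T" and x: "lam (Suc k) \<le> ereal x" "ereal x \<le> lam k"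
  shows "u x = piece k x"
proof -
  obtain z where "lam (Suc k) = ereal z" "0 \<le> z" using run_next[OF k] by auto
  then have "0 \<le> x" using x by simp
  then obtain j where j: "j < T" "lam (Suc j) \<le> ereal x" "ereal x \<le> lam j" "u x = piece j x"
    using path by (auto simp: is_dual_path_def)
  then show ?thesis
    using run_pieces_agree[of j k x] run_pieces_agree[of k j x] k x by (cases "j \<le> k") auto
qed

lemma path_variational:
  assumes "0 \<le> x"
  shows "dual_variational yt Dt x (u x)"
proof -
  obtain k where k: "k < T" "lam (Suc k) \<le> ereal x" "ereal x \<le> lam k" "u x = piece k x"
    using path assms by (auto simp: is_dual_path_def)
  then show ?thesis using run_variational[OF k(1)] by simp
qed

lemma path_continuous: "continuous_on {0..} u"
proof -
  define I where "I k = {x. lam (Suc k) \<le> ereal x \<and> ereal x \<le> lam k} \<inter> {0..}" for k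
  have cover: "{0..} = (\<Union>k\<in>{..<T}. I k)"
    using path by (auto simp: is_dual_path_def I_def)
  have "closed (I k)" for k
    unfolding I_def by (intro closed_Int closed_Collect_conj closed_Collect_le continuous_intros
      closed_atLeast) 
  moreover have "continuous_on (I k) u" if "k < T" for k
  proof -
    obtain c v where "\<forall>l. piece k l = c + l *\<^sub>R v"
      using path_piece_affine[of yt Dt "B k" "s k"] by (elim exE)
    then have "u x = c + x *\<^sub>R v" if "x \<in> I k" for x
      using path_eq_piece[OF \<open>k < T\<close>] that by (auto simp: I_def)
    then have "continuous_on (I k) u \<longleftrightarrow> continuous_on (I k) (\<lambda>x. c + x *\<^sub>R v)"
      by (intro continuous_on_cong) auto
    then show ?thesis by (simp add: continuous_intros)
  qed
  ultimately show ?thesis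
    unfolding cover by (intro continuous_on_closed_Union) auto
qed

lemma path_affine_off_visited:
  assumes I: "is_interval I" "I \<subseteq> {0..} - visited T lam"
  shows "\<exists>c v. \<forall>x\<in>I. u x = c + x *\<^sub>R v"
proof (cases "I = {}")
  case True
  then show ?thesis by simp
next
  case False
  then obtain x where x: "x \<in> I" by blast
  then have "x \<in> {0..}" using I(2) by blast
  then have "0 \<le> x" by simp
  then obtain k where k: "k < T" "lam (Suc k) \<le> ereal x" "ereal x \<le> lam k"
    using path unfolding is_dual_path_def by blast
  have visited: "z \<notin> I" if "lam j = ereal z" "j \<le> T" for j z
  proof -
    have "j \<noteq> 0" using that(1) run_start by (intro notI) simp
    then have "lam j \<in> lam ` {1..T}" using that(2) by simp
    then have "z \<in> visited T lam" by (simp add: visited_def that(1))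
    then show ?thesis using I(2) by blast
  qed
  have within: "lam (Suc k) \<le> ereal y \<and> ereal y \<le> lam k" if y: "y \<in> I" for y
  proof (intro conjI)
    obtain z where z: "lam (Suc k) = ereal z" using run_next[OF k(1)] by auto
    show "lam (Suc k) \<le> ereal y"
    proof (rule ccontr)
      assume "\<not> lam (Suc k) \<le> ereal y"
      then have "y \<le> z" by (simp add: z)
      moreover have "z \<le> x" using k(2) by (simp add: z)
      ultimately have "z \<in> I" using mem_is_interval_1_I[OF I(1) y x] by simp
      then show False using visited[OF z] k(1) by simp
    qed
    show "ereal y \<le> lam k"
    proof (cases "lam k")
      case (real z)
      show ?thesis
      proof (rule ccontr)
        assume "\<not> ereal y \<le> lam k"
        then have "z \<le> y" by (simp add: real)
        moreover have "x \<le> z" using k(3) by (simp add: real)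
        ultimately have "z \<in> I" using mem_is_interval_1_I[OF I(1) x y] by simp
        then show False using visited[OF real] k(1) by simp
      qed
    next
      case MInf
      then show ?thesis using k(3) by simp
    qed simp
  qed
  have u: "u y = piece k y" if "y \<in> I" for y
    by (rule path_eq_piece[OF k(1)]) (simp_all add: within[OF that])
  obtain c v where "\<forall>l. piece k l = c + l *\<^sub>R v"
    using path_piece_affine[of yt Dt "B k" "s k"] by (elim exE)
  then have "\<forall>x\<in>I. u x = c + x *\<^sub>R v" by (simp add: u)
  then show ?thesis by blast
qed

lemma path_locally_affine:
  assumes "0 < x" "x \<notin> visited T lam"
  shows "\<exists>a b c v. a < x \<and> x < b \<and> (\<forall>y\<in>{a<..<b}. u y = c + y *\<^sub>R v)"
proof -
  have op: "open ({0<..} - visited T lam)"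
    by (rule open_Diff[OF open_greaterThan finite_imp_closed[OF finite_visited]])
  have "x \<in> {0<..} - visited T lam" using assms by simp
  then obtain e where e: "0 < e" "ball x e \<subseteq> {0<..} - visited T lam"
    by (rule openE[OF op])
  have "is_interval {x - e<..<x + e}" "{x - e<..<x + e} \<subseteq> {0..} - visited T lam"
    using e(2) by (auto simp: is_interval_1 ball_eq_greaterThanLessThan)
  then obtain c v where "\<forall>y\<in>{x - e<..<x + e}. u y = c + y *\<^sub>R v"
    using path_affine_off_visited[of "{x - e<..<x + e}"] by auto
  then show ?thesis using e(1) by (intro exI[of _ "x - e"] exI[of _ "x + e"] exI[of _ c] exI[of _ v]) simp
qed

lemma path_piecewise_linear: "piecewise_linear_on {0..} u"
  unfolding piecewise_linear_on_def
  by (intro exI[of _ "visited T lam"] conjI allI impI finite_visited path_affine_off_visited) auto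

end

end


section \<open>Kinks\<close>

lemma has_vector_derivative_one_sided_affine:
  fixes f :: "real \<Rightarrow> 'a::real_normed_vector"
  assumes "open U" "x \<in> U" "\<And>y. y \<in> U \<Longrightarrow> y \<in> S \<Longrightarrow> f y = c + y *\<^sub>R v" "f x = c + x *\<^sub>R v"
  shows "(f has_vector_derivative v) (at x within S)"
proof -
  have "((\<lambda>y. c + y *\<^sub>R v) has_vector_derivative v) (at x within S)"
    by (auto intro!: derivative_eq_intros)
  moreover have "eventually (\<lambda>y. y \<in> S \<longrightarrow> f y = c + y *\<^sub>R v) (nhds x)"
    unfolding eventually_nhds using assms(1-3) by (intro exI[of _ U]) simp
  ultimately show ?thesis
    using has_vector_derivative_cong_ev[of S f "\<lambda>y. c + y *\<^sub>R v" x v] assms(4) by simp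
qed

lemma not_kink_affine:
  fixes f :: "real \<Rightarrow> 'a::real_normed_vector"
  assumes "a < x" "x < b" and f: "\<And>y. y \<in> {a<..<b} \<Longrightarrow> f y = c + y *\<^sub>R v"
  shows "x \<notin> kinks f"
proof
  assume "x \<in> kinks f"
  then obtain p q where "p \<noteq> q" and p: "(f has_vector_derivative p) (at_left x)"
    and q: "(f has_vector_derivative q) (at_right x)"
    by (auto simp: kinks_def)
  have v: "(f has_vector_derivative v) (at x within S)" for S
    using assms by (intro has_vector_derivative_one_sided_affine[of "{a<..<b}"]) auto
  have "p = v" "q = v"
    using vector_derivative_unique_within[OF trivial_limit_at_left_real p v]
      vector_derivative_unique_within[OF trivial_limit_at_right_real q v] by simp_all
  then show False using \<open>p \<noteq> q\<close> by simp
qed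

lemma kink_of_two_slopes:
  fixes f :: "real \<Rightarrow> 'a::real_normed_vector"
  assumes "0 < x" "a < x" "x < b" "v \<noteq> w"
    and left: "\<And>y. a \<le> y \<Longrightarrow> y \<le> x \<Longrightarrow> f y = c + y *\<^sub>R v"
    and right: "\<And>y. x \<le> y \<Longrightarrow> y \<le> b \<Longrightarrow> f y = d + y *\<^sub>R w"
  shows "x \<in> kinks f"
proof -
  have "(f has_vector_derivative v) (at_left x)"
    using assms(2) left by (intro has_vector_derivative_one_sided_affine[of "{a<..}"]) auto
  moreover have "(f has_vector_derivative w) (at_right x)"
    using assms(3) right by (intro has_vector_derivative_one_sided_affine[of "{..<b}"]) auto
  ultimately show ?thesis using assms(1,4) by (auto simp: kinks_def)
qed

text \<open>
  At a visited value the pieces on the two sides agree. If they also had the same slope they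
  would coincide, and the upper piece would stay optimal below the value where an event ended it.
\<close>

lemma kinks_dual_path:
  assumes run: "dual_path_run yt Dt T lam B s" and path: "is_dual_path yt Dt T lam B s u"
  shows "kinks u = visited T lam - {0}"
proof (intro equalityI subsetI)
  fix x assume x: "x \<in> kinks u"
  then have "0 < x" by (simp add: kinks_def)
  moreover have "x \<in> visited T lam"
  proof (rule ccontr)
    assume "x \<notin> visited T lam"
    then obtain a b c v where "a < x" "x < b" "\<forall>y\<in>{a<..<b}. u y = c + y *\<^sub>R v"
      using path_locally_affine[OF run path \<open>0 < x\<close>] by auto
    then show False using not_kink_affine[of a x b u c v] x by simp
  qed
  ultimately show "x \<in> visited T lam - {0}" by simp
next
  fix x assume x: "x \<in> visited T lam - {0}"
  let ?piece = "\<lambda>k. path_piece yt Dt (B k) (s k)"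
  have "0 \<le> x"
  proof -
    obtain k where "k < T" "lam (Suc k) = ereal x"
    proof -
      obtain m where "m \<in> {1..T}" "lam m = ereal x" using x by (auto simp: visited_def)
      then show thesis using that[of "m - 1"] by (cases m) auto
    qed
    then show ?thesis using run_next[OF run \<open>k < T\<close>] by auto
  qed
  then have "0 < x" using x by simp
  obtain i j where ij: "i < j" "j < T" "lam (Suc i) = ereal x" "ereal x < lam i"
    "lam j = ereal x" "lam (Suc j) < ereal x"
    using run_event_neighbours[OF run _ \<open>0 < x\<close>] x by blast
  have "i < T" using ij by simp
  obtain a where a: "lam (Suc j) = ereal a" "a < x" "0 \<le> a"
    using run_next[OF run ij(2)] ij(6) by auto
  obtain b where b: "x < b" "ereal b \<le> lam i"
  proof (cases "lam i")
    case (real r)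
    then show thesis using that[of r] ij(4) by simp
  qed (use ij(4) that[of "x + 1"] in auto)
  obtain c v where v: "\<forall>l. ?piece j l = c + l *\<^sub>R v"
    using path_piece_affine[of yt Dt "B j" "s j"] by (elim exE)
  obtain d w where w: "\<forall>l. ?piece i l = d + l *\<^sub>R w"
    using path_piece_affine[of yt Dt "B i" "s i"] by (elim exE)
  have left: "u y = ?piece j y" if "a \<le> y" "y \<le> x" for y
    using path_eq_piece[OF run path ij(2)] a(1) ij(5) that by simp
  have right: "u y = ?piece i y" if "x \<le> y" "y \<le> b" for y
  proof (rule path_eq_piece[OF run path \<open>i < T\<close>])
    show "ereal y \<le> lam i" using order_trans[of "ereal y" "ereal b"] that b(2) by simp
  qed (use ij(3) that in simp)
  have "v \<noteq> w"
  proof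
    assume "v = w"
    moreover have "?piece j x = ?piece i x" using left[of x] right[of x] a(2) b(1) by simp
    ultimately have same: "?piece j l = ?piece i l" for l by (simp add: v w)
    define l where "l = (a + x) / 2"
    have l: "0 < l" "a \<le> l" "l < x" using a by (auto simp: l_def)
    have "u l = ?piece i l"
      by (rule trans[OF left[OF l(2) less_imp_le[OF l(3)]] same])
    then have "dual_variational yt Dt l (?piece i l)"
      by (rule subst) (rule path_variational[OF run path less_imp_le[OF l(1)]])
    then show False
      by (rule notE[OF run_exit[OF run \<open>i < T\<close> ij(3,4) l(1,3)]])
  qed
  then show "x \<in> kinks u"
    by (rule kink_of_two_slopes[OF \<open>0 < x\<close> a(2) b(1), where c = c and d = d])
       (simp_all only: left right v w)
qed


section \<open>The primal path\<close>

text \<open>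
  With \<open>p\<close> a dual solution, \<open>X *v \<beta>\<^sub>0\<close> is the dual residual and \<open>D *v \<beta>\<^sub>0\<close> the dual
  gradient, so the first-order condition says that \<open>p\<close> is \<open>l\<close> times a subgradient of the
  1-norm at \<open>D *v \<beta>\<^sub>0\<close>. The excess objective of any \<open>\<beta>\<close> is then at least half of
  \<open>norm (X *v (\<beta> - \<beta>\<^sub>0))\<^sup>2\<close>, and \<open>X\<close> is injective.
\<close>

lemma primal_solution_iff:
  fixes X :: "real^'p^'n" and D :: "real^'p^'m"
  assumes rank: "rank X = CARD('p)" and "0 \<le> l"
    and opt: "dual_variational (y_tilde X y) (D_tilde X D) l p"
  shows "primal_solution X D y l \<beta> \<longleftrightarrow>
    \<beta> = rect_pinv X *v (y_tilde X y - transpose (D_tilde X D) *v p)"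
proof -
  define R where "R = rect_pinv X"
  have RX: "R ** X = mat 1" and sym: "transpose (X ** R) = X ** R"
    using rect_pinv_full_rank[OF rank] by (simp_all add: R_def)
  define r where "r = y_tilde X y - transpose (D_tilde X D) *v p"
  define \<beta>0 where "\<beta>0 = R *v r"
  have yt: "y_tilde X y = X ** R *v y" and Dt: "D_tilde X D = D ** R"
    by (simp_all add: y_tilde_def D_tilde_def R_def)
  have XRX: "X ** R ** X = X" and DRX: "D ** R ** X = D"
    by (simp_all add: RX matrix_mul_assoc[symmetric])
  have "transpose (D_tilde X D) = transpose (D ** R ** (X ** R))"
    by (simp add: Dt matrix_mul_assoc DRX)
  also have "\<dots> = X ** R ** transpose (D_tilde X D)"
    by (simp only: matrix_transpose_mul[of "D ** R" "X ** R"] sym Dt)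
  finally have "X ** R ** transpose (D_tilde X D) = transpose (D_tilde X D)" ..
  then have X\<beta>0: "X *v \<beta>0 = r"
    by (simp add: \<beta>0_def r_def yt matrix_vector_mult_diff_distrib matrix_vector_mul_assoc
        matrix_mul_assoc XRX)
  define g where "g = D *v \<beta>0"
  have g: "g = dual_grad (y_tilde X y) (D_tilde X D) p"
    by (simp add: g_def \<beta>0_def r_def Dt matrix_vector_mul_assoc)
  have box: "\<bar>p $ i\<bar> \<le> l" for i using opt by (simp add: dual_variational_def)
  have subgrad: "l * (\<Sum>i\<in>UNIV. \<bar>g $ i\<bar>) \<le> p \<bullet> g"
  proof -
    define v where "v = (\<chi> i. l * sgn (g $ i))"
    have "\<forall>i. \<bar>v $ i\<bar> \<le> l" using \<open>0 \<le> l\<close> by (simp add: v_def abs_mult abs_sgn_eq)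
    then have "g \<bullet> (v - p) \<le> 0" using opt by (simp add: dual_variational_def g)
    then have "g \<bullet> v \<le> p \<bullet> g" by (simp add: inner_diff_right inner_commute)
    moreover have "g \<bullet> v = l * (\<Sum>i\<in>UNIV. \<bar>g $ i\<bar>)"
      by (simp add: inner_vec_def v_def sum_distrib_left abs_sgn mult.left_commute)
    ultimately show ?thesis by simp
  qed
  have holder: "p \<bullet> z \<le> l * (\<Sum>i\<in>UNIV. \<bar>z $ i\<bar>)" for z :: "real^'m"
  proof -
    have "p $ i * z $ i \<le> l * \<bar>z $ i\<bar>" for i
    proof -
      have "p $ i * z $ i \<le> \<bar>p $ i\<bar> * \<bar>z $ i\<bar>" by (metis abs_ge_self abs_mult)
      also have "\<dots> \<le> l * \<bar>z $ i\<bar>" using box by (intro mult_right_mono) auto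
      finally show ?thesis .
    qed
    then show ?thesis by (simp add: inner_vec_def sum_distrib_left sum_mono)
  qed
  have excess: "genlasso_objective X D y l \<beta>0 + 1/2 * (norm (X *v (\<beta> - \<beta>0)))\<^sup>2
      \<le> genlasso_objective X D y l \<beta>" for \<beta>
  proof -
    let ?w = "X *v (\<beta> - \<beta>0)"
    have Pw: "X ** R *v ?w = ?w"
      by (simp add: matrix_vector_mul_assoc XRX)
    have "y \<bullet> ?w = (X ** R *v y) \<bullet> ?w"
      unfolding inner_matrix_vector_transpose[of "X ** R" y] sym Pw ..
    then have "(y - X *v \<beta>0) \<bullet> ?w = (transpose (D_tilde X D) *v p) \<bullet> ?w"
      by (simp add: X\<beta>0 r_def yt inner_diff_left)
    also have "\<dots> = p \<bullet> (D_tilde X D *v ?w)"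
      by (simp add: inner_matrix_vector_transpose)
    also have "D_tilde X D *v ?w = D *v \<beta> - g"
      by (simp add: Dt matrix_vector_mul_assoc DRX g_def matrix_vector_mult_diff_distrib)
    finally have cross: "(y - X *v \<beta>0) \<bullet> ?w = p \<bullet> (D *v \<beta>) - p \<bullet> g"
      by (simp add: inner_diff_right)
    have split: "y - X *v \<beta> = (y - X *v \<beta>0) - ?w"
      by (simp add: matrix_vector_mult_diff_distrib)
    have sq: "(norm (a - b))\<^sup>2 = (norm a)\<^sup>2 - 2 * (a \<bullet> b) + (norm b)\<^sup>2" for a b :: "real^'n"
      by (simp add: power2_norm_eq_inner inner_diff inner_commute)
    have norm_eq: "(norm (y - X *v \<beta>))\<^sup>2 =
        (norm (y - X *v \<beta>0))\<^sup>2 - 2 * (p \<bullet> (D *v \<beta>) - p \<bullet> g) + (norm ?w)\<^sup>2"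
      unfolding split sq[of "y - X *v \<beta>0"] cross ..
    have combine: "1/2 * a + G + 1/2 * w \<le> 1/2 * n + H"
      if "n = a - 2 * (q - r) + w" "q \<le> H" "G \<le> r" for a G w n H q r :: real
      using that by argo
    show ?thesis
      unfolding genlasso_objective_def g_def[symmetric] by (rule combine[OF norm_eq holder subgrad])
  qed
  show ?thesis
    unfolding primal_solution_def is_arg_min_linorder r_def[symmetric] R_def[symmetric]
      \<beta>0_def[symmetric]
  proof
    assume "True \<and> (\<forall>b. True \<longrightarrow> genlasso_objective X D y l \<beta> \<le> genlasso_objective X D y l b)"
    then have min: "genlasso_objective X D y l \<beta> \<le> genlasso_objective X D y l \<beta>0" by blast
    have "1/2 * (norm (X *v (\<beta> - \<beta>0)))\<^sup>2 \<le> 0"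
      using order_trans[OF excess[of \<beta>] min] by simp
    then have "X *v (\<beta> - \<beta>0) = 0" by simp
    then have "R *v (X *v (\<beta> - \<beta>0)) = 0" by simp
    then have "R ** X *v (\<beta> - \<beta>0) = 0" by (simp only: matrix_vector_mul_assoc)
    then show "\<beta> = \<beta>0" by (simp add: RX)
  next
    assume "\<beta> = \<beta>0"
    moreover have "genlasso_objective X D y l \<beta>0 \<le> genlasso_objective X D y l b" for b
      by (rule order_trans[OF _ excess]) simp
    ultimately show
      "True \<and> (\<forall>b. True \<longrightarrow> genlasso_objective X D y l \<beta> \<le> genlasso_objective X D y l b)"
      by simp
  qed
qed

lemma primal_path_affine_image:
  "\<exists>c L. linear L \<and> (\<forall>l. primal_path X D y u l = c + L (u l))"
proof -
  let ?L = "\<lambda>w. - (rect_pinv X *v (transpose (D_tilde X D) *v w))"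
  have "linear ?L"
    by (intro linearI) (simp_all add: matrix_vector_right_distrib matrix_vector_mult_scaleR)
  moreover have "primal_path X D y u l = rect_pinv X *v y_tilde X y + ?L (u l)" for l
    by (simp add: primal_path_def matrix_vector_mult_diff_distrib)
  ultimately show ?thesis by (intro exI[of _ "rect_pinv X *v y_tilde X y"] exI[of _ ?L]) simp
qed

lemma primal_path_continuous:
  assumes "continuous_on {0..} u"
  shows "continuous_on {0..} (primal_path X D y u)"
proof -
  obtain c L where L: "linear L" "\<forall>l. primal_path X D y u l = c + L (u l)"
    using primal_path_affine_image[of X D y u] by (elim exE conjE)
  have "continuous_on {0..} (\<lambda>l. c + L (u l))"
    by (intro continuous_on_add continuous_on_const linear_continuous_on_compose[OF assms L(1)])
  moreover have "primal_path X D y u = (\<lambda>l. c + L (u l))"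
    using L(2) by (simp add: fun_eq_iff)
  ultimately show ?thesis by (simp only:)
qed

lemma primal_path_piecewise_linear:
  assumes "piecewise_linear_on {0..} u"
  shows "piecewise_linear_on {0..} (primal_path X D y u)"
proof -
  obtain c L where L: "linear L" "\<forall>l. primal_path X D y u l = c + L (u l)"
    using primal_path_affine_image[of X D y u] by (elim exE conjE)
  obtain K where K: "finite K"
    "\<forall>I. is_interval I \<and> I \<subseteq> {0..} - K \<longrightarrow> (\<exists>a v. \<forall>x\<in>I. u x = a + x *\<^sub>R v)"
    using assms unfolding piecewise_linear_on_def by (elim exE conjE)
  show ?thesis
    unfolding piecewise_linear_on_def
  proof (intro exI[of _ K] conjI allI impI K(1))
    fix I assume "is_interval I \<and> I \<subseteq> {0..} - K"
    then obtain a v where av: "\<forall>x\<in>I. u x = a + x *\<^sub>R v" using K(2) by presburger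
    have "\<forall>x\<in>I. primal_path X D y u x = (c + L a) + x *\<^sub>R L v"
      using av by (simp add: L(2) linear_add[OF L(1)] linear_scale[OF L(1)])
    then show "\<exists>a v. \<forall>x\<in>I. primal_path X D y u x = a + x *\<^sub>R v" by blast
  qed
qed

lemma kinks_primal_path:
  assumes run: "dual_path_run yt Dt T lam B s" and path: "is_dual_path yt Dt T lam B s u"
  shows "kinks (primal_path X D y u) \<subseteq> visited T lam"
proof
  fix x assume x: "x \<in> kinks (primal_path X D y u)"
  then have "0 < x" by (simp add: kinks_def)
  obtain c L where L: "linear L" "\<forall>l. primal_path X D y u l = c + L (u l)"
    using primal_path_affine_image[of X D y u] by (elim exE conjE)
  show "x \<in> visited T lam"
  proof (rule ccontr)
    assume "x \<notin> visited T lam"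
    then obtain a b d v where "a < x" "x < b" "\<forall>y\<in>{a<..<b}. u y = d + y *\<^sub>R v"
      using path_locally_affine[OF run path \<open>0 < x\<close>] by auto
    then have "x \<notin> kinks (primal_path X D y u)"
      by (intro not_kink_affine[of a x b _ "c + L d" "L v"])
         (simp_all add: L(2) linear_add[OF L(1)] linear_scale[OF L(1)])
    then show False using x by simp
  qed
qed


section \<open>A breakpoint that is invisible in the primal path\<close>

lemma rank_identity_pinv: "rect_pinv (mat 1 :: real^'p^'p) = mat 1"
  using rect_pinv_left_inverse[of "mat 1 :: real^'p^'p"] by (simp add: rank_I)

text \<open>
  With the two proportional rows \<open>2\<close> and \<open>1\<close> the dual residual can vanish on a whole range of
  \<open>l\<close>: the first dual coordinate hits the boundary at \<open>2\<close>, and down to \<open>5/3\<close> the second one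
  compensates for its decrease. So the primal solution stays 0 and shows no kink at \<open>2\<close>. In the last
  step all event times are 0 and the rule removes some coordinate; coordinate \<open>1\<close> is chosen.
\<close>

definition y_ex :: "real^1" where "y_ex = vec 5"
definition D_ex :: "real^1^2" where "D_ex = vector [vec 2, vec 1]"

definition lam_ex :: "nat \<Rightarrow> ereal" where
  "lam_ex k = (if k = 0 then \<infinity> else if k = 1 then 2 else if k = 2 then ereal (5/3) else 0)"
definition B_ex :: "nat \<Rightarrow> 2 set" where
  "B_ex k = (if k = 0 then {} else if k = 1 then {1} else if k = 2 then UNIV else {2})"
definition s_ex :: "nat \<Rightarrow> real^2" where
  "s_ex k = (if k = 0 then 0 else if k = 1 then vector [1, 0] else if k = 2 then vector [1, 1]
    else vector [0, 1])"
definition u_ex :: "real \<Rightarrow> real^2" where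
  "u_ex x = (if 2 \<le> x then vector [2, 1] else if 5/3 \<le> x then vector [x, 5 - 2 * x]
    else vector [x, x])"

lemma sets_of_type_2: "- {} = {1, 2::2}" "- {1::2} = {2}" "UNIV - {1::2} = {2}"
  unfolding set_eq_iff forall_2 by simp_all

lemma mult_1_nth: "((A :: real^1^'m) *v x) $ i = A $ i $ 1 * x $ 1"
  by (simp add: matrix_vector_mult_def)

lemma transpose_mult_2_nth: "(transpose (A :: real^1^2) *v w) $ 1 = A $ 1 $ 1 * w $ 1 + A $ 2 $ 1 * w $ 2"
  by (simp add: matrix_vector_mult_def transpose_def sum_2)

lemma D_ex_nth: "D_ex $ 1 $ 1 = 2" "D_ex $ 2 $ 1 = 1"
  by (simp_all add: D_ex_def)

lemma ls_pinv_D_ex: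
  "ls_pinv D_ex {} *v z = vector [2/5 * z $ 1, 1/5 * z $ 1]"
  "ls_pinv D_ex {1} *v z = vector [0, z $ 1]"
  "ls_pinv D_ex UNIV *v z = 0"
proof -
  show "ls_pinv D_ex {} *v z = vector [2/5 * z $ 1, 1/5 * z $ 1]"
    by (rule sym, subst ls_pinv_iff, intro conjI exI[of _ "vec (z $ 1 / 5)"])
       (simp_all add: vec_eq_iff forall_2 mult_1_nth transpose_mult_2_nth rows_in_def D_ex_nth)
  show "ls_pinv D_ex {1} *v z = vector [0, z $ 1]"
    by (rule sym, subst ls_pinv_iff, intro conjI exI[of _ z])
       (simp_all add: vec_eq_iff forall_2 mult_1_nth transpose_mult_2_nth rows_in_def D_ex_nth)
  show "ls_pinv D_ex UNIV *v z = 0"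
    by (rule sym, subst ls_pinv_iff, intro conjI exI[of _ 0])
       (simp_all add: vec_eq_iff forall_2 mult_1_nth transpose_mult_2_nth rows_in_def D_ex_nth)
qed

lemma coefs_ex:
  "coef_a y_ex D_ex {} = vector [2, 1]" "coef_b D_ex {} 0 = 0"
  "coef_a y_ex D_ex {1} = vector [0, 5]" "coef_b D_ex {1} (vector [1, 0]) = vector [0, 2]"
  by (simp_all add: coef_a_def coef_b_def ls_pinv_D_ex y_ex_def vec_eq_iff forall_2
      transpose_mult_2_nth rows_in_def D_ex_nth)

lemma pieces_ex:
  "path_piece y_ex D_ex {} 0 x = vector [2, 1]"
  "path_piece y_ex D_ex {1} (vector [1, 0]) x = vector [x, 5 - 2 * x]"
  "path_piece y_ex D_ex UNIV (vector [1, 1]) x = vector [x, x]"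
  by (simp_all add: path_piece_def coefs_ex vec_eq_iff forall_2)

lemma leave_ex:
  "leave_time y_ex D_ex {1} (vector [1, 0]) 1 = 0"
  "leave_time y_ex D_ex UNIV (vector [1, 1]) i = 0"
proof -
  have "coef_c y_ex D_ex {1} (vector [1, 0]) 1 = 0"
    by (simp add: coef_c_def resid_proj_def matrix_vector_mult_diff_rdistrib
        matrix_vector_mul_assoc[symmetric] ls_pinv_D_ex mult_1_nth transpose_mult_2_nth
        rows_in_def D_ex_nth y_ex_def)
  then show "leave_time y_ex D_ex {1} (vector [1, 0]) 1 = 0" by (simp add: leave_time_def)
  have "0 \<le> coef_c y_ex D_ex UNIV (vector [1, 1]) i"
    using exhaust_2[of i]
    by (auto simp: coef_c_def resid_proj_def matrix_vector_mult_diff_rdistrib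
        matrix_vector_mul_assoc[symmetric] ls_pinv_D_ex mult_1_nth
        rows_in_def D_ex_nth y_ex_def)
  then show "leave_time y_ex D_ex UNIV (vector [1, 1]) i = 0" by (simp add: leave_time_def)
qed

lemma run_ex: "dual_path_run y_ex D_ex 3 lam_ex B_ex s_ex"
proof -
  have step0: "dual_step y_ex D_ex \<infinity> {} 0 2 {1} (vector [1, 0])"
    unfolding dual_step_def
  proof (intro exI conjI)
    let ?t = "\<lambda>i::2. if i = 1 then 2 else 1 :: real"
    show "\<forall>i\<in>- {}. is_hit_time \<infinity> (coef_a y_ex D_ex {} $ i) (coef_b D_ex {} 0 $ i) (?t i)"
      by (simp only: sets_of_type_2) (auto simp: coefs_ex is_hit_time_def)
    have h: "max_or_zero ?t (- {}) = 2" by (simp only: sets_of_type_2) (simp add: max_or_zero_def)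
    show "2 = max_or_zero ?t (- {})" using h by simp
    show "0 = max_or_zero (leave_time y_ex D_ex {} 0) {}" by (simp add: max_or_zero_def)
    show "2 = ereal (max 2 0)" by simp
    show "if (2::real) > 0 then \<exists>i\<in>- {}. ?t i = 2 \<and> {1} = insert i {} \<and>
        vector [1, 0] = (\<chi> j. if j = i then sgn (path_piece y_ex D_ex {} 0 (max 2 0) $ i) else 0 $ j)
      else if ({}::2 set) = {} then {1} = ({}::2 set) \<and> vector [1, 0] = (0::real^2)
      else \<exists>i\<in>{}. leave_time y_ex D_ex {} 0 i = 0 \<and> {1} = {} - {i} \<and>
        vector [1, 0] = (\<chi> j. if j = i then 0 else 0 $ j)"
      by (simp add: pieces_ex vec_eq_iff forall_2)
  qed
  have step1: "dual_step y_ex D_ex 2 {1} (vector [1, 0]) (ereal (5/3)) UNIV (vector [1, 1])"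
    unfolding dual_step_def
  proof (intro exI conjI)
    let ?s = "vector [1, 0] :: real^2" and ?t = "\<lambda>i::2. 5/3 :: real"
    show "\<forall>i\<in>- {1}. is_hit_time 2 (coef_a y_ex D_ex {1} $ i) (coef_b D_ex {1} ?s $ i) (?t i)"
      using ereal_less_eq(3)[of "5/3" 2] by (auto simp: sets_of_type_2 coefs_ex is_hit_time_def)
    show "5/3 = max_or_zero ?t (- {1})" by (simp add: max_or_zero_def sets_of_type_2)
    show "0 = max_or_zero (leave_time y_ex D_ex {1} ?s) {1}" by (simp add: max_or_zero_def leave_ex)
    show "ereal (5/3) = ereal (max (5/3) 0)" by simp
    show "if (5/3::real) > 0 then \<exists>i\<in>- {1}. ?t i = 5/3 \<and> UNIV = insert i {1} \<and>
        vector [1, 1] = (\<chi> j. if j = i then sgn (path_piece y_ex D_ex {1} ?s (max (5/3) 0) $ i) else ?s $ j)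
      else if {1::2} = {} then UNIV = {1::2} \<and> vector [1, 1] = ?s
      else \<exists>i\<in>{1}. leave_time y_ex D_ex {1} ?s i = 0 \<and> UNIV = {1} - {i} \<and>
        vector [1, 1] = (\<chi> j. if j = i then 0 else ?s $ j)"
      by (simp add: pieces_ex vec_eq_iff forall_2 UNIV_2 insert_commute sets_of_type_2)
  qed
  have step2: "dual_step y_ex D_ex (ereal (5/3)) UNIV (vector [1, 1]) 0 {2} (vector [0, 1])"
    unfolding dual_step_def
  proof (intro exI conjI)
    let ?s = "vector [1, 1] :: real^2" and ?t = "\<lambda>i::2. 0 :: real"
    show "\<forall>i\<in>- UNIV. is_hit_time (ereal (5/3)) (coef_a y_ex D_ex UNIV $ i) (coef_b D_ex UNIV ?s $ i) (?t i)"
      by simp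
    show "0 = max_or_zero ?t (- UNIV)" by (simp add: max_or_zero_def)
    show "0 = max_or_zero (leave_time y_ex D_ex UNIV ?s) UNIV"
      by (simp add: max_or_zero_def leave_ex image_constant_conv)
    show "0 = ereal (max 0 0)" by simp
    show "if (0::real) > 0 then \<exists>i\<in>- UNIV. ?t i = 0 \<and> {2} = insert i UNIV \<and>
        vector [0, 1] = (\<chi> j. if j = i then sgn (path_piece y_ex D_ex UNIV ?s (max 0 0) $ i) else ?s $ j)
      else if (UNIV::2 set) = {} then {2} = (UNIV::2 set) \<and> vector [0, 1] = ?s
      else \<exists>i\<in>UNIV. leave_time y_ex D_ex UNIV ?s i = 0 \<and> {2} = UNIV - {i} \<and>
        vector [0, 1] = (\<chi> j. if j = i then 0 else ?s $ j)"
      using leave_ex(2) by (simp, intro exI[of _ 1]) (simp add: vec_eq_iff forall_2 sets_of_type_2)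
  qed
  have "dual_step y_ex D_ex (lam_ex k) (B_ex k) (s_ex k) (lam_ex (Suc k)) (B_ex (Suc k)) (s_ex (Suc k))"
    if "k < 3" for k
  proof -
    have "k = 0 \<or> k = 1 \<or> k = 2" using that by auto
    then show ?thesis
      using step0 step1 step2 by (auto simp: lam_ex_def B_ex_def s_ex_def)
  qed
  then show ?thesis
    by (auto simp: dual_path_run_def lam_ex_def B_ex_def s_ex_def)
qed

lemma path_ex: "is_dual_path y_ex D_ex 3 lam_ex B_ex s_ex u_ex"
  unfolding is_dual_path_def
proof (intro allI impI)
  fix x :: real assume "0 \<le> x"
  consider "2 \<le> x" | "5/3 \<le> x" "x < 2" | "x < 5/3" by linarith
  then show "\<exists>k<3. lam_ex (Suc k) \<le> ereal x \<and> ereal x \<le> lam_ex k \<and>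
    u_ex x = path_piece y_ex D_ex (B_ex k) (s_ex k) x"
  proof cases
    case 1
    then show ?thesis
      by (intro exI[of _ 0]) (simp add: lam_ex_def B_ex_def s_ex_def u_ex_def pieces_ex)
  next
    case 2
    then show ?thesis
      by (intro exI[of _ 1]) (simp add: lam_ex_def B_ex_def s_ex_def u_ex_def pieces_ex)
  next
    case 3
    then show ?thesis using \<open>0 \<le> x\<close>
      by (intro exI[of _ 2]) (simp add: lam_ex_def B_ex_def s_ex_def u_ex_def pieces_ex zero_ereal_def)
  qed
qed

lemma identity_tilde:
  "y_tilde (mat 1 :: real^'p^'p) y = y" "D_tilde (mat 1 :: real^'p^'p) D = D"
  by (simp_all add: y_tilde_def D_tilde_def rank_identity_pinv)

lemma not_kink_ex: "2 \<notin> kinks (primal_path (mat 1) D_ex y_ex u_ex)"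
proof (rule not_kink_affine[of "5/3" _ 3 _ 0 0])
  fix x :: real assume "x \<in> {5/3<..<3}"
  then show "primal_path (mat 1) D_ex y_ex u_ex x = 0 + x *\<^sub>R 0"
    by (auto simp: primal_path_def identity_tilde rank_identity_pinv vec_eq_iff
        transpose_mult_2_nth D_ex_nth u_ex_def y_ex_def)
qed auto

lemma visited_ex: "2 \<in> visited 3 lam_ex"
proof -
  have "ereal 2 = lam_ex 1" by (simp add: lam_ex_def)
  then show ?thesis unfolding visited_def by auto
qed

lemma kinks_subset_positive: "kinks f \<subseteq> {0<..}"
  by (auto simp: kinks_def)

lemma strict_inclusion_example:
  "\<exists>(X0 :: real^1^1) (D0 :: real^1^2) y0 T0 lam0 B0 s0 u0.
        rank X0 = CARD(1) \<and> rank D0 < CARD(2) \<and>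
        dual_path_run (y_tilde X0 y0) (D_tilde X0 D0) T0 lam0 B0 s0 \<and>
        is_dual_path (y_tilde X0 y0) (D_tilde X0 D0) T0 lam0 B0 s0 u0 \<and>
        kinks (primal_path X0 D0 y0 u0) \<subset> visited T0 lam0 - {0}"
proof -
  let ?X = "mat 1 :: real^1^1"
  have "kinks (primal_path ?X D_ex y_ex u_ex) \<subseteq> visited 3 lam_ex"
    by (rule kinks_primal_path[OF run_ex path_ex])
  moreover have "kinks (primal_path ?X D_ex y_ex u_ex) \<subseteq> {0<..}"
    by (rule kinks_subset_positive)
  ultimately have "kinks (primal_path ?X D_ex y_ex u_ex) \<subseteq> visited 3 lam_ex - {0}"
    by auto
  moreover have "2 \<in> visited 3 lam_ex - {0}" using visited_ex by simp
  ultimately have kinks: "kinks (primal_path ?X D_ex y_ex u_ex) \<subset> visited 3 lam_ex - {0}"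
    using not_kink_ex by blast
  have "rank D_ex \<le> min CARD(2) CARD(1)" by (rule rank_bound)
  then have rank: "rank D_ex < CARD(2)" by simp
  show ?thesis
    by (intro exI[of _ ?X] exI[of _ D_ex] exI[of _ y_ex] exI[of _ 3] exI[of _ lam_ex]
        exI[of _ B_ex] exI[of _ s_ex] exI[of _ u_ex] conjI)
       (simp_all only: identity_tilde run_ex path_ex kinks rank rank_I)
qed

theorem mainTheorem4:
  fixes X :: "real^'p^'n" and D :: "real^'p^'m" and y :: "real^'n"
    and T :: nat and lam :: "nat \<Rightarrow> ereal" and B :: "nat \<Rightarrow> 'm set" and s :: "nat \<Rightarrow> real^'m"
    and u :: "real \<Rightarrow> real^'m"
  assumes "rank X = CARD('p)"
    and "dual_path_run (y_tilde X y) (D_tilde X D) T lam B s"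
    and "is_dual_path (y_tilde X y) (D_tilde X D) T lam B s u"
  shows
    "((\<forall>l\<ge>0. dual_solution (y_tilde X y) (D_tilde X D) l (u l)) \<and>
      piecewise_linear_on {0..} u \<and>
      kinks u = visited T lam - {0} \<and>
      continuous_on {0..} u)
     \<and>
     ((\<forall>l\<ge>0. \<forall>\<beta>. primal_solution X D y l \<beta> \<longleftrightarrow> \<beta> = primal_path X D y u l) \<and>
      continuous_on {0..} (primal_path X D y u) \<and>
      piecewise_linear_on {0..} (primal_path X D y u) \<and>
      kinks (primal_path X D y u) \<subseteq> visited T lam)
     \<and>
     (\<exists>(X0 :: real^1^1) (D0 :: real^1^2) y0 T0 lam0 B0 s0 u0.
        rank X0 = CARD(1) \<and> rank D0 < CARD(2) \<and>
        dual_path_run (y_tilde X0 y0) (D_tilde X0 D0) T0 lam0 B0 s0 \<and>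
        is_dual_path (y_tilde X0 y0) (D_tilde X0 D0) T0 lam0 B0 s0 u0 \<and>
        kinks (primal_path X0 D0 y0 u0) \<subset> visited T0 lam0 - {0})"
proof (intro conjI allI impI)
  note opt = path_variational[OF assms(2,3)]
  fix l :: real assume l: "0 \<le> l"
  show "dual_solution (y_tilde X y) (D_tilde X D) l (u l)"
    by (rule dual_variational_imp_solution[OF opt[OF l]])
  show "primal_solution X D y l \<beta> \<longleftrightarrow> \<beta> = primal_path X D y u l" for \<beta>
    unfolding primal_path_def by (rule primal_solution_iff[OF assms(1) l opt[OF l]])
next
  note pl = path_piecewise_linear[OF assms(2,3)] and cont = path_continuous[OF assms(2,3)]
  show "piecewise_linear_on {0..} u" "continuous_on {0..} u" by (rule pl cont)+
  show "kinks u = visited T lam - {0}" by (rule kinks_dual_path[OF assms(2,3)])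
  show "continuous_on {0..} (primal_path X D y u)" by (rule primal_path_continuous[OF cont])
  show "piecewise_linear_on {0..} (primal_path X D y u)"
    by (rule primal_path_piecewise_linear[OF pl])
  show "kinks (primal_path X D y u) \<subseteq> visited T lam" by (rule kinks_primal_path[OF assms(2,3)])
qed (rule strict_inclusion_example)

end
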